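(* Let $K$ be a field, let $P=K[x_1,\dots,x_n]$, let $\mathfrak{M}=\langle x_1,\dots,x_n\rangle$, let $1\le s\le n$, and let $Z=(z_1,\dots,z_s)$ be a tuple of pairwise distinct indeterminates in $\{x_1,\dots,x_n\}$. Let $f_1,\dots,f_s\in\mathfrak{M}\setminus\{0\}$, let $F=(f_1,\dots,f_s)$, and let $I_F=\langle f_1,\dots,f_s\rangle$. Then the following hold. (a) If $F$ is a $Z$-separating tuple, then $f_i$ is $z_i$-separating for $i=1,\dots,s$. (b) The tuple $F$ is coherently $Z$-separating if and only if $f_i$ is $z_i$-separating for $i=1,\dots,s$ and $z_i$ does not divide any term in $\mathrm{Supp}(f_j)$ for all $i,j\in\{1,\dots,s\}$ with $j\ne i$. (c) If the ideal $I_F$ is $Z$-separating and $\sigma$ is a $Z$-separating term ordering for $I_F$, then the reduced $\sigma$-Gröbner basis of $I_F$ (listed as a tuple whose $i$-th entry has $\sigma$-leading term $z_i$) is coherently $Z$-separating. (d) If $F$ is a $Z$-separating tuple and $\sigma$ is a $Z$-separating term ordering for $F$, then the ideal $I_F$ is $Z$-separating and $\sigma$ is a $Z$-separating term ordering for $I_F$. Moreover, the reduced $\sigma$-Gröbner basis of $I_F$ is obtained by making the polynomials in $F$ monic and interreducing them. (e) If the ideal $I_F$ is $Z$-separating and $\sigma$ is an elimination ordering for $Z$, then $\sigma\in\mathrm{Sep}_Z(I_F)$.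
   Context: A term is a power product $x_1^{\alpha_1}\cdots x_n^{\alpha_n}$; $\mathrm{Supp}(f)$ is the set of terms occurring in $f$ with nonzero coefficient. A term ordering is a multiplicative total well-ordering on the monoid of terms $\mathbb{T}^n$. For a term ordering $\sigma$, $\mathrm{LT}_\sigma(f)$ is the $\sigma$-largest term in $\mathrm{Supp}(f)$ (without coefficient), $\mathrm{LC}_\sigma(f)$ is its coefficient, and $\mathrm{LT}_\sigma(I)$ is the ideal generated by the leading terms of the nonzero elements of $I$. Write $\langle Z\rangle=\langle z_1,\dots,z_s\rangle$ and let $Y$ be the tuple of indeterminates in $\{x_1,\dots,x_n\}\setminus\{z_1,\dots,z_s\}$. Definitions. - $f_i$ is $z_i$-separating if $z_i\in\mathrm{Supp}(f_i)$ and $z_i$ does not divide any other term in $\mathrm{Supp}(f_i)$. - The tuple $F$ is $Z$-separating if there is a term ordering $\sigma$ with $\mathrm{LT}_\sigma(f_i)=z_i$ for $i=1,\dots,s$; such a $\sigma$ is called a $Z$-separating term ordering for $F$. - The tuple $F$ is coherently $Z$-separating if there is a term ordering $\sigma$ with $\mathrm{LT}_\sigma(f_i)=z_i$ for $i=1,\dots,s$ such that, additionally, the reduced $\sigma$-Gröbner basis of $I_F$ is $\{\frac{1}{c_1}f_1,\dots,\frac{1}{c_s}f_s\}$, where $c_i=\mathrm{LC}_\sigma(f_i)$. - The ideal $I_F$ is $Z$-separating if there is a term ordering $\sigma$ with $\mathrm{LT}_\sigma(I_F)=\langle Z\rangle$; such a $\sigma$ is called a $Z$-separating term ordering for $I_F$.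 The set of all $Z$-separating term orderings for $I_F$ is denoted by $\mathrm{Sep}_Z(I_F)$. - A term ordering $\sigma$ is an elimination ordering for $Z$ if every nonzero $f\in P$ with $\mathrm{LT}_\sigma(f)\in K[Y]$ satisfies $f\in K[Y]$. - Interreducing a finite list of monic polynomials means repeatedly replacing a polynomial by a remainder of its division (with respect to $\sigma$) by the other ones until no term in the support of any of the polynomials is divisible by the leading term of another one. *)

theory Defs
  imports Complex_Main "HOL-Library.Poly_Mapping" "HOL-Library.Cardinality"
begin

text \<open>
  Terms are exponent vectors, written additively; the indeterminates are indexed by the
  type \<open>'n\<close>, which is finite wherever the polynomial ring has finitely many indeterminates.
  Polynomials form the monoid ring of the terms, so the support of \<open>f\<close> is \<open>keys f\<close>.
\<close>

type_synonym 'n pp = "'n \<Rightarrow>\<^sub>0 nat"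
type_synonym ('n, 'k) mpoly = "'n pp \<Rightarrow>\<^sub>0 'k"

definition indet :: "'n \<Rightarrow> 'n pp" where
  "indet x = Poly_Mapping.single x 1"

definition pp_dvd :: "'n pp \<Rightarrow> 'n pp \<Rightarrow> bool" where
  "pp_dvd s t \<longleftrightarrow> (\<exists>u. t = s + u)"

definition monomial_of :: "'n pp \<Rightarrow> ('n, 'k::field) mpoly" where
  "monomial_of t = Poly_Mapping.single t 1"

definition const :: "'k::field \<Rightarrow> ('n, 'k) mpoly" where
  "const c = Poly_Mapping.single 0 c"

text \<open>Ideals are the submodules of the ring regarded as a module over itself.\<close>

definition ideal_gen :: "('n, 'k::field) mpoly set \<Rightarrow> ('n, 'k) mpoly set" where
  "ideal_gen B = module.span (*) B"

definition indet_ideal :: "'n set \<Rightarrow> ('n, 'k::field) mpoly set" where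
  "indet_ideal X = ideal_gen ((\<lambda>x. monomial_of (indet x)) ` X)"

definition polys_in :: "'n set \<Rightarrow> ('n, 'k::field) mpoly set" where
  "polys_in Y = {f. \<forall>t\<in>Poly_Mapping.keys f. Poly_Mapping.keys t \<subseteq> Y}"

text \<open>\<open>(s, t) \<in> \<sigma>\<close> means that \<open>s\<close> is less than or equal to \<open>t\<close>.\<close>

definition term_ordering :: "'n pp rel \<Rightarrow> bool" where
  "term_ordering \<sigma> \<longleftrightarrow>
     well_order_on UNIV \<sigma> \<and> (\<forall>s t u. (s, t) \<in> \<sigma> \<longrightarrow> (s + u, t + u) \<in> \<sigma>)"

text \<open>The leading term is meaningful for nonzero polynomials only.\<close>

definition LT :: "'n pp rel \<Rightarrow> ('n, 'k::field) mpoly \<Rightarrow> 'n pp" where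
  "LT \<sigma> f = (THE t. t \<in> Poly_Mapping.keys f \<and> (\<forall>u\<in>Poly_Mapping.keys f. (u, t) \<in> \<sigma>))"

definition LC :: "'n pp rel \<Rightarrow> ('n, 'k::field) mpoly \<Rightarrow> 'k" where
  "LC \<sigma> f = Poly_Mapping.lookup f (LT \<sigma> f)"

definition make_monic :: "'n pp rel \<Rightarrow> ('n, 'k::field) mpoly \<Rightarrow> ('n, 'k) mpoly" where
  "make_monic \<sigma> f = const (1 / LC \<sigma> f) * f"

definition LT_ideal :: "'n pp rel \<Rightarrow> ('n, 'k::field) mpoly set \<Rightarrow> ('n, 'k) mpoly set" where
  "LT_ideal \<sigma> A = ideal_gen {monomial_of (LT \<sigma> f) |f. f \<in> A \<and> f \<noteq> 0}"

definition is_Groebner_basis ::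
    "'n pp rel \<Rightarrow> ('n, 'k::field) mpoly set \<Rightarrow> ('n, 'k) mpoly set \<Rightarrow> bool" where
  "is_Groebner_basis \<sigma> I G \<longleftrightarrow>
     finite G \<and> G \<subseteq> I - {0} \<and> LT_ideal \<sigma> G = LT_ideal \<sigma> I"

definition is_reduced_Groebner_basis ::
    "'n pp rel \<Rightarrow> ('n, 'k::field) mpoly set \<Rightarrow> ('n, 'k) mpoly set \<Rightarrow> bool" where
  "is_reduced_Groebner_basis \<sigma> I G \<longleftrightarrow>
     is_Groebner_basis \<sigma> I G \<and>
     (\<forall>g\<in>G. LC \<sigma> g = 1 \<and> (\<forall>h\<in>G - {g}. \<forall>t\<in>Poly_Mapping.keys g. \<not> pp_dvd (LT \<sigma> h) t))"

definition separating_poly :: "'n \<Rightarrow> ('n, 'k::field) mpoly \<Rightarrow> bool" where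
  "separating_poly z f \<longleftrightarrow>
     indet z \<in> Poly_Mapping.keys f \<and> (\<forall>t\<in>Poly_Mapping.keys f - {indet z}. \<not> pp_dvd (indet z) t)"

definition separating_ordering_tuple ::
    "'n list \<Rightarrow> ('n, 'k::field) mpoly list \<Rightarrow> 'n pp rel \<Rightarrow> bool" where
  "separating_ordering_tuple zs fs \<sigma> \<longleftrightarrow>
     term_ordering \<sigma> \<and> (\<forall>i<length zs. LT \<sigma> (fs ! i) = indet (zs ! i))"

definition separating_tuple :: "'n list \<Rightarrow> ('n, 'k::field) mpoly list \<Rightarrow> bool" where
  "separating_tuple zs fs \<longleftrightarrow> (\<exists>\<sigma>. separating_ordering_tuple zs fs \<sigma>)"

definition coherently_separating_tuple ::
    "'n list \<Rightarrow> ('n, 'k::field) mpoly list \<Rightarrow> bool" where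
  "coherently_separating_tuple zs fs \<longleftrightarrow>
     (\<exists>\<sigma>. separating_ordering_tuple zs fs \<sigma> \<and>
          is_reduced_Groebner_basis \<sigma> (ideal_gen (set fs)) (make_monic \<sigma> ` set fs))"

definition Sep :: "'n list \<Rightarrow> ('n, 'k::field) mpoly set \<Rightarrow> 'n pp rel set" where
  "Sep zs I = {\<sigma>. term_ordering \<sigma> \<and> LT_ideal \<sigma> I = indet_ideal (set zs)}"

definition separating_ideal :: "'n list \<Rightarrow> ('n, 'k::field) mpoly set \<Rightarrow> bool" where
  "separating_ideal zs I \<longleftrightarrow> (\<exists>\<sigma>. \<sigma> \<in> Sep zs I)"

text \<open>The type argument fixes the coefficient field of the polynomials quantified over.\<close>

definition elimination_ordering ::
    "'k::field itself \<Rightarrow> 'n list \<Rightarrow> 'n pp rel \<Rightarrow> bool" where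
  "elimination_ordering (_ :: 'k itself) zs \<sigma> \<longleftrightarrow>
     term_ordering \<sigma> \<and>
     (\<forall>f :: ('n, 'k) mpoly. f \<noteq> 0 \<longrightarrow>
        (monomial_of (LT \<sigma> f) :: ('n, 'k) mpoly) \<in> polys_in (- set zs) \<longrightarrow>
        f \<in> polys_in (- set zs))"

text \<open>
  A remainder is anything meeting the specification of the division algorithm; this
  covers its output for every order of the divisors and every choice of reducers.
\<close>

definition is_remainder ::
    "'n pp rel \<Rightarrow> ('n, 'k::field) mpoly \<Rightarrow> ('n, 'k) mpoly list \<Rightarrow> ('n, 'k) mpoly \<Rightarrow> bool" where
  "is_remainder \<sigma> f gs r \<longleftrightarrow>
     (\<exists>q. f = (\<Sum>j<length gs. q j * gs ! j) + r \<and>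
          (\<forall>j<length gs. q j * gs ! j \<noteq> 0 \<longrightarrow>
             f \<noteq> 0 \<and> (LT \<sigma> (q j * gs ! j), LT \<sigma> f) \<in> \<sigma>)) \<and>
     (\<forall>t\<in>Poly_Mapping.keys r. \<forall>g\<in>set gs. g \<noteq> 0 \<longrightarrow> \<not> pp_dvd (LT \<sigma> g) t)"

definition reducible_at :: "'n pp rel \<Rightarrow> ('n, 'k::field) mpoly list \<Rightarrow> nat \<Rightarrow> bool" where
  "reducible_at \<sigma> gs i \<longleftrightarrow>
     (\<exists>t\<in>Poly_Mapping.keys (gs ! i). \<exists>j<length gs. j \<noteq> i \<and> gs ! j \<noteq> 0 \<and> pp_dvd (LT \<sigma> (gs ! j)) t)"

definition interreduced :: "'n pp rel \<Rightarrow> ('n, 'k::field) mpoly list \<Rightarrow> bool" where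
  "interreduced \<sigma> gs \<longleftrightarrow> (\<forall>i<length gs. \<not> reducible_at \<sigma> gs i)"

definition interreduction_step ::
    "'n pp rel \<Rightarrow> ('n, 'k::field) mpoly list \<Rightarrow> ('n, 'k) mpoly list \<Rightarrow> bool" where
  "interreduction_step \<sigma> gs gs' \<longleftrightarrow>
     (\<exists>i<length gs. \<exists>r. reducible_at \<sigma> gs i \<and>
        is_remainder \<sigma> (gs ! i) (take i gs @ drop (Suc i) gs) r \<and> gs' = gs[i := r])"

definition interreduces_to ::
    "'n pp rel \<Rightarrow> ('n, 'k::field) mpoly list \<Rightarrow> ('n, 'k) mpoly list \<Rightarrow> bool" where
  "interreduces_to \<sigma> fs gs \<longleftrightarrow> (interreduction_step \<sigma>)\<^sup>*\<^sup>* fs gs \<and> interreduced \<sigma> gs"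

text \<open>Whatever choices are made, the procedure stops, and the polynomials left form the set \<open>G\<close>.\<close>

definition interreduction_yields ::
    "'n pp rel \<Rightarrow> ('n, 'k::field) mpoly list \<Rightarrow> ('n, 'k) mpoly set \<Rightarrow> bool" where
  "interreduction_yields \<sigma> fs G \<longleftrightarrow>
     (\<nexists>S. S 0 = fs \<and> (\<forall>k. interreduction_step \<sigma> (S k) (S (Suc k)))) \<and>
     (\<exists>gs. interreduces_to \<sigma> fs gs) \<and>
     (\<forall>gs. interreduces_to \<sigma> fs gs \<longrightarrow> set gs = G)"

end

theory Submission
  imports Defs
begin

text \<open>
  Write \<open>Y\<close> for the indeterminates outside \<open>Z\<close>. Everything rests on one criterion
  (\<open>LT_ideal_eqI\<close>, \<open>LT_ideal_eqD\<close>): for an ideal \<open>I\<close>, the leading terms of \<open>I\<close> generate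
  \<open>\<langle>Z\<rangle>\<close> if and only if every \<open>z \<in> Z\<close> is the leading term of some element of \<open>I\<close> and
  \<open>I \<inter> K[Y] = 0\<close>. Indeed, division by elements of \<open>I\<close> with leading terms \<open>z \<in> Z\<close> moves every
  polynomial into \<open>K[Y]\<close> modulo \<open>I\<close>; if the leading term of a nonzero \<open>f \<in> I\<close> avoided \<open>Z\<close>,
  reducing the tail of \<open>f\<close> would produce a nonzero element of \<open>I \<inter> K[Y]\<close>.

  If \<open>F\<close> has the leading terms \<open>z\<^sub>1, \<dots>, z\<^sub>s\<close>, then \<open>I\<^sub>F \<inter> K[Y] = 0\<close>
  (\<open>triangular_elimination\<close>): all indeterminates in the tail of \<open>f\<^sub>i\<close> are smaller than
  \<open>z\<^sub>i\<close>, so solving \<open>f\<^sub>i = 0\<close> for \<open>z\<^sub>i\<close> recursively, from the smallest \<open>z\<^sub>i\<close> upwards, defines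
  a homomorphism onto \<open>K[Y]\<close> that fixes \<open>K[Y]\<close> and kills \<open>I\<^sub>F\<close>. This gives the first half
  of (d).

  When the leading terms of \<open>I\<close> generate \<open>\<langle>Z\<rangle>\<close>, the reduced Groebner basis consists of the
  unique elements \<open>z\<^sub>i - h\<^sub>i\<close> of \<open>I\<close> with \<open>h\<^sub>i \<in> K[Y]\<close>; this gives (c). For (e), the only term of
  \<open>z\<^sub>i - h\<^sub>i\<close> outside \<open>K[Y]\<close> is \<open>z\<^sub>i\<close>, so it is the leading term for every elimination
  ordering, and the criterion applies, since \<open>I \<inter> K[Y] = 0\<close> does not involve the ordering.

  For (a), no proper multiple of a leading term \<open>z\<^sub>i\<close> can occur beside it. In (b), the support
  conditions are necessary by (a) and by the definition of a reduced Groebner basis. Conversely, they say that \<open>f\<^sub>i\<close> is a scalar multiple of \<open>z\<^sub>i - h\<^sub>i\<close>, and a lexicographic ordering that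
  puts \<open>Z\<close> first makes all \<open>z\<^sub>i\<close> leading terms. For the second half of (d), an interreduction step
  keeps all leading terms and makes the \<open>i\<close>-th polynomial irreducible for good
  (\<open>interreduction_step_invariant\<close>), so at most \<open>s\<close> steps are possible; the result has the
  form \<open>z\<^sub>i - h\<^sub>i\<close> and is therefore independent of the choices made.
\<close>

section \<open>Polynomials and ideals\<close>

lemma mpoly_induct [case_names zero add]:
  fixes f :: "'a \<Rightarrow>\<^sub>0 'b::comm_monoid_add"
  assumes "P 0" and "\<And>t c f. P f \<Longrightarrow> P (Poly_Mapping.single t c + f)"
  shows "P f"
proof (induction f rule: update_induct)
  case const
  show ?case by (rule assms(1))
next
  case (update f t c)
  have "Poly_Mapping.update t c f = Poly_Mapping.single t c + f"
    using update(1)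
    by (intro poly_mapping_eqI) (auto simp: lookup_update lookup_add lookup_single when_def in_keys_iff)
  then show ?case using update assms(2) by metis
qed

lemma lookup_single_mult:
  fixes g :: "('n, 'k::field) mpoly"
  shows "Poly_Mapping.lookup (Poly_Mapping.single u a * g) (u + t) = a * Poly_Mapping.lookup g t"
proof (induction g rule: mpoly_induct)
  case (add t' c g)
  then show ?case
    by (simp add: distrib_left mult_single lookup_add lookup_single when_def)
qed simp

lemma lookup_const_mult:
  "Poly_Mapping.lookup (const c * f) t = c * Poly_Mapping.lookup f t"
  using lookup_single_mult[of 0 c f t] by (simp add: const_def)

lemma keys_const_mult: "c \<noteq> 0 \<Longrightarrow> Poly_Mapping.keys (const c * f) = Poly_Mapping.keys f"
  by (auto simp: in_keys_iff lookup_const_mult)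

lemma keys_single_mult:
  assumes "k \<in> Poly_Mapping.keys (Poly_Mapping.single u a * g)"
  obtains t where "t \<in> Poly_Mapping.keys g" "k = u + t"
proof -
  have "Poly_Mapping.keys (Poly_Mapping.single u a) \<subseteq> {u}" by simp
  then show ?thesis using keys_mult[of "Poly_Mapping.single u a" g] assms that by blast
qed

lemma keys_add_cases:
  "k \<in> Poly_Mapping.keys (f + g) \<Longrightarrow> k \<in> Poly_Mapping.keys f \<or> k \<in> Poly_Mapping.keys g"
  using keys_add[of f g] by auto

lemma keys_diff_cases:
  fixes f g :: "('n, 'k::field) mpoly"
  shows "k \<in> Poly_Mapping.keys (f - g) \<Longrightarrow> k \<in> Poly_Mapping.keys f \<or> k \<in> Poly_Mapping.keys g"
  by (auto simp: in_keys_iff lookup_minus)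

lemma pp_dvd_indet_iff: "pp_dvd (indet z) t \<longleftrightarrow> z \<in> Poly_Mapping.keys t"
proof
  assume "pp_dvd (indet z) t"
  then show "z \<in> Poly_Mapping.keys t"
    by (auto simp: pp_dvd_def indet_def in_keys_iff lookup_add)
next
  assume "z \<in> Poly_Mapping.keys t"
  then have "t = indet z + (t - indet z)"
    by (intro poly_mapping_eqI)
      (auto simp: indet_def lookup_add lookup_minus lookup_single when_def in_keys_iff)
  then show "pp_dvd (indet z) t" unfolding pp_dvd_def by blast
qed

lemma keys_indet [simp]: "Poly_Mapping.keys (indet z) = {z}"
  by (simp add: indet_def)

lemma indet_eq_iff [simp]: "indet x = indet y \<longleftrightarrow> x = y"
  using keys_indet[of x] keys_indet[of y] by (metis singleton_inject)

lemma pp_dvd_indetD: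
  assumes "pp_dvd t (indet z)" "t \<noteq> 0"
  shows "t = indet z"
proof -
  obtain u where u: "indet z = t + u" using assms(1) unfolding pp_dvd_def by blast
  have *: "Poly_Mapping.lookup t x + Poly_Mapping.lookup u x = (if x = z then 1 else 0)" for x
    using arg_cong[OF u, of "\<lambda>f. Poly_Mapping.lookup f x"]
    by (auto simp: indet_def lookup_add lookup_single when_def)
  obtain x where "Poly_Mapping.lookup t x \<noteq> 0" using assms(2) by (metis poly_mapping_eqI lookup_zero)
  then have "Poly_Mapping.lookup t z = 1" using *[of x] by (auto split: if_splits)
  moreover have "Poly_Mapping.lookup t x = 0" if "x \<noteq> z" for x using *[of x] that by simp
  ultimately show ?thesis
    by (intro poly_mapping_eqI) (auto simp: indet_def lookup_single when_def)
qed

lemma polys_in_add: "f \<in> polys_in Y \<Longrightarrow> g \<in> polys_in Y \<Longrightarrow> f + g \<in> polys_in Y"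
  using keys_add_cases by (fastforce simp: polys_in_def)

lemma polys_in_diff: "f \<in> polys_in Y \<Longrightarrow> g \<in> polys_in Y \<Longrightarrow> f - g \<in> polys_in Y"
  using keys_diff_cases by (fastforce simp: polys_in_def)

lemma polys_in_mult:
  assumes "f \<in> polys_in Y" "g \<in> polys_in Y"
  shows "f * g \<in> polys_in Y"
proof -
  have "Poly_Mapping.keys t \<subseteq> Y" if t: "t \<in> Poly_Mapping.keys (f * g)" for t
  proof -
    obtain a b where "a \<in> Poly_Mapping.keys f" "b \<in> Poly_Mapping.keys g" "t = a + b" using t keys_mult[of f g] by blast
    then show ?thesis using assms keys_add[of a b] unfolding polys_in_def by blast
  qed
  then show ?thesis by (simp add: polys_in_def)
qed

lemma polys_in_zero: "0 \<in> polys_in Y"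
  by (simp add: polys_in_def)

lemma polys_in_const [simp]: "const c \<in> polys_in Y"
  by (auto simp: polys_in_def const_def split: if_splits)

lemma const_1: "const 1 = 1"
  by (simp add: const_def)

lemma polys_in_power: "f \<in> polys_in Y \<Longrightarrow> f ^ m \<in> polys_in Y"
  by (induction m) (auto intro: polys_in_mult polys_in_const[of 1, unfolded const_1])

lemma polys_in_prod: "(\<And>x. x \<in> A \<Longrightarrow> f x \<in> polys_in Y) \<Longrightarrow> prod f A \<in> polys_in Y"
  by (induction A rule: infinite_finite_induct)
    (auto intro: polys_in_mult polys_in_const[of 1, unfolded const_1])

lemma polys_in_sum: "(\<And>x. x \<in> A \<Longrightarrow> f x \<in> polys_in Y) \<Longrightarrow> sum f A \<in> polys_in Y"
  by (induction A rule: infinite_finite_induct) (simp_all add: polys_in_add polys_in_zero)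

lemma module_mult: "module ((*) :: ('n, 'k::field) mpoly \<Rightarrow> _)"
  by unfold_locales (simp_all add: algebra_simps)

lemmas ideal_gen_base = module.span_base[OF module_mult, folded ideal_gen_def]
  and ideal_gen_add = module.span_add[OF module_mult, folded ideal_gen_def]
  and ideal_gen_diff = module.span_diff[OF module_mult, folded ideal_gen_def]
  and ideal_gen_mult = module.span_scale[OF module_mult, folded ideal_gen_def]
  and ideal_gen_sum = module.span_sum[OF module_mult, folded ideal_gen_def]

lemma ideal_gen_minimal:
  assumes "B \<subseteq> J" "0 \<in> J" "\<And>f g. f \<in> J \<Longrightarrow> g \<in> J \<Longrightarrow> f + g \<in> J" "\<And>h f. f \<in> J \<Longrightarrow> h * f \<in> J"
  shows "ideal_gen B \<subseteq> J"
  unfolding ideal_gen_def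
  using assms by (intro module.span_minimal[OF module_mult] module.subspaceI[OF module_mult])

lemma ideal_gen_subset: "B \<subseteq> ideal_gen C \<Longrightarrow> ideal_gen B \<subseteq> ideal_gen C"
  by (rule ideal_gen_minimal)
    (auto intro: ideal_gen_add ideal_gen_mult module.span_zero[OF module_mult, folded ideal_gen_def])

text \<open>The terms of the elements of a monomial ideal are multiples of the generating terms.\<close>

lemma keys_monomial_ideal:
  assumes "f \<in> ideal_gen (monomial_of ` U)" "t \<in> Poly_Mapping.keys f"
  shows "\<exists>u\<in>U. pp_dvd u t"
proof -
  let ?J = "{f :: ('a, 'b) mpoly. \<forall>t\<in>Poly_Mapping.keys f. \<exists>u\<in>U. pp_dvd u t}"
  have "ideal_gen (monomial_of ` U) \<subseteq> ?J"
  proof (rule ideal_gen_minimal)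
    have "pp_dvd u u" for u :: "'a pp" unfolding pp_dvd_def by (metis add_0_right)
    then show "monomial_of ` U \<subseteq> ?J" by (force simp: monomial_of_def)
  next
    show "f + g \<in> ?J" if "f \<in> ?J" "g \<in> ?J" for f g using that keys_add_cases by fastforce
  next
    fix h f assume f: "f \<in> ?J"
    show "h * f \<in> ?J"
    proof clarify
      fix t assume "t \<in> Poly_Mapping.keys (h * f)"
      then obtain a b where ab: "b \<in> Poly_Mapping.keys f" "t = a + b" using keys_mult[of h f] by blast
      then obtain u v where "u \<in> U" "b = u + v" using f unfolding pp_dvd_def by blast
      then have "t = u + (a + v)" using ab by (simp add: ac_simps)
      then show "\<exists>u\<in>U. pp_dvd u t" using \<open>u \<in> U\<close> unfolding pp_dvd_def by blast
    qed
  qed simp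
  then show ?thesis using assms by blast
qed

lemma monomial_in_monomial_ideal:
  assumes "u \<in> U" "pp_dvd u t"
  shows "monomial_of t \<in> ideal_gen (monomial_of ` U)"
proof -
  obtain v where v: "t = v + u" using assms(2) unfolding pp_dvd_def by (metis add.commute)
  have "monomial_of v * monomial_of u \<in> ideal_gen (monomial_of ` U)"
    using assms(1) by (intro ideal_gen_mult ideal_gen_base imageI)
  then show ?thesis by (simp add: v monomial_of_def mult_single)
qed

lemma LT_ideal_eq: "LT_ideal \<sigma> A = ideal_gen (monomial_of ` (LT \<sigma> ` (A - {0})))"
  unfolding LT_ideal_def by (rule arg_cong[where f = ideal_gen]) auto

lemma indet_ideal_eq: "indet_ideal X = ideal_gen (monomial_of ` (indet ` X))"
  unfolding indet_ideal_def by (simp add: image_image)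

lemma LT_ideal_mono: "A \<subseteq> B \<Longrightarrow> LT_ideal \<sigma> A \<subseteq> LT_ideal \<sigma> B"
  unfolding LT_ideal_eq ideal_gen_def by (intro module.span_mono[OF module_mult]) auto

text \<open>
  Here \<open>A\<close> is any set of polynomials. A leading term dividing \<open>z\<close> is \<open>z\<close> or \<open>1\<close>, and \<open>1\<close> is
  excluded by the first condition.
\<close>

lemma LT_ideal_eq_indet_ideal_iff:
  fixes A :: "('n, 'k::field) mpoly set"
  shows "LT_ideal \<sigma> A = indet_ideal Z \<longleftrightarrow>
    (\<forall>f\<in>A - {0}. \<exists>z\<in>Z. z \<in> Poly_Mapping.keys (LT \<sigma> f)) \<and>
    (\<forall>z\<in>Z. \<exists>f\<in>A - {0}. LT \<sigma> f = indet z)"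
    (is "?L = ?R \<longleftrightarrow> ?P \<and> ?Q")
proof (intro iffI conjI)
  assume eq: "?L = ?R"
  show ?P
  proof
    fix f assume "f \<in> A - {0}"
    then have "monomial_of (LT \<sigma> f) \<in> ?R"
      unfolding eq[symmetric] LT_ideal_eq by (intro ideal_gen_base) auto
    then have "\<exists>u\<in>indet ` Z. pp_dvd u (LT \<sigma> f)"
      unfolding indet_ideal_eq by (rule keys_monomial_ideal) (simp add: monomial_of_def)
    then show "\<exists>z\<in>Z. z \<in> Poly_Mapping.keys (LT \<sigma> f)" by (auto simp: pp_dvd_indet_iff)
  qed
  show ?Q
  proof
    fix z assume "z \<in> Z"
    then have "monomial_of (indet z) \<in> ?L"
      unfolding eq indet_ideal_eq by (intro ideal_gen_base) auto
    then have "\<exists>u\<in>LT \<sigma> ` (A - {0}). pp_dvd u (indet z)"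
      unfolding LT_ideal_eq by (rule keys_monomial_ideal) (simp add: monomial_of_def)
    then obtain f where f: "f \<in> A - {0}" "pp_dvd (LT \<sigma> f) (indet z)" by blast
    obtain x where "x \<in> Poly_Mapping.keys (LT \<sigma> f)" using \<open>?P\<close> f(1) by blast
    then have "LT \<sigma> f \<noteq> 0" by auto
    with f(2) have "LT \<sigma> f = indet z" by (rule pp_dvd_indetD)
    then show "\<exists>f\<in>A - {0}. LT \<sigma> f = indet z" using f(1) by (rule bexI)
  qed
next
  assume PQ: "?P \<and> ?Q"
  have "?L \<subseteq> ?R"
    unfolding LT_ideal_eq indet_ideal_eq
  proof (rule ideal_gen_subset, rule image_subsetI)
    fix t assume "t \<in> LT \<sigma> ` (A - {0})"
    then obtain z where "z \<in> Z" "z \<in> Poly_Mapping.keys t" using PQ by blast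
    then show "monomial_of t \<in> ideal_gen (monomial_of ` indet ` Z)"
      by (intro monomial_in_monomial_ideal[of "indet z"]) (auto simp: pp_dvd_indet_iff)
  qed
  moreover have "?R \<subseteq> ?L"
    unfolding LT_ideal_eq indet_ideal_eq
  proof (rule ideal_gen_subset, clarify)
    fix z assume "z \<in> Z"
    then obtain f where "f \<in> A - {0}" "LT \<sigma> f = indet z" using PQ by blast
    then have "indet z \<in> LT \<sigma> ` (A - {0})" by (metis image_eqI)
    then show "monomial_of (indet z) \<in> ideal_gen (monomial_of ` LT \<sigma> ` (A - {0}))"
      by (intro ideal_gen_base) blast
  qed
  ultimately show "?L = ?R" by (rule equalityI)
qed

section \<open>Substitution homomorphisms\<close>

text \<open>The value of \<open>f\<close> when each indeterminate \<open>x\<close> is replaced by the polynomial \<open>y x\<close>.\<close>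

definition subst :: "('n::finite \<Rightarrow> ('n, 'k::field) mpoly) \<Rightarrow> ('n, 'k) mpoly \<Rightarrow> ('n, 'k) mpoly" where
  "subst y f =
     (\<Sum>t\<in>Poly_Mapping.keys f. const (Poly_Mapping.lookup f t) * (\<Prod>x\<in>UNIV. y x ^ Poly_Mapping.lookup t x))"

lemma subst_zero [simp]: "subst y 0 = 0"
  by (simp add: subst_def)

lemma subst_add: "subst y (f + g) = subst y f + subst y g"
  unfolding subst_def
  by (rule setsum_keys_plus_distrib) (simp_all add: const_def single_add distrib_right)

lemma subst_single:
  "subst y (Poly_Mapping.single t c) = const c * (\<Prod>x\<in>UNIV. y x ^ Poly_Mapping.lookup t x)"
  by (cases "c = 0") (simp_all add: subst_def const_def)

lemma subst_mult:
  fixes y :: "'n::finite \<Rightarrow> ('n, 'k::field) mpoly"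
  shows "subst y (f * g) = subst y f * subst y g"
proof (induction f rule: mpoly_induct)
  case (add t c f)
  have "subst y (Poly_Mapping.single t c * g) = subst y (Poly_Mapping.single t c) * subst y g"
  proof (induction g rule: mpoly_induct)
    case (add u d g)
    have "const (c * d) = (const c * const d :: ('n, 'k) mpoly)" by (simp add: const_def mult_single)
    then have "subst y (Poly_Mapping.single t c * Poly_Mapping.single u d) =
        subst y (Poly_Mapping.single t c) * subst y (Poly_Mapping.single u d)"
      by (simp only: mult_single subst_single lookup_add power_add prod.distrib mult_ac)
    with add show ?case by (simp add: distrib_left subst_add)
  qed simp
  with add show ?case by (simp add: distrib_right subst_add)
qed simp

lemma subst_cong:
  assumes "\<And>t x. t \<in> Poly_Mapping.keys f \<Longrightarrow> x \<in> Poly_Mapping.keys t \<Longrightarrow> y x = y' x"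
  shows "subst y f = subst y' f"
  unfolding subst_def
proof (intro sum.cong refl arg_cong2[where f = "(*)"] prod.cong)
  fix t x assume "t \<in> Poly_Mapping.keys f"
  then show "y x ^ Poly_Mapping.lookup t x = y' x ^ Poly_Mapping.lookup t x"
    using assms[of t x] by (cases "Poly_Mapping.lookup t x = 0") (auto simp: in_keys_iff)
qed

lemma subst_in_polys_in:
  assumes "\<And>t x. t \<in> Poly_Mapping.keys f \<Longrightarrow> x \<in> Poly_Mapping.keys t \<Longrightarrow> y x \<in> polys_in Y"
  shows "subst y f \<in> polys_in Y"
  unfolding subst_def
proof (intro polys_in_sum polys_in_mult polys_in_const polys_in_prod)
  fix t x assume "t \<in> Poly_Mapping.keys f"
  then show "y x ^ Poly_Mapping.lookup t x \<in> polys_in Y"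
    using assms[of t x] polys_in_const[of 1, unfolded const_1]
    by (cases "Poly_Mapping.lookup t x = 0") (auto simp: in_keys_iff intro: polys_in_power)
qed

lemma subst_indet: "subst y (monomial_of (indet z)) = y z"
proof -
  have "(\<Prod>x\<in>UNIV. y x ^ Poly_Mapping.lookup (indet z) x) = (\<Prod>x\<in>UNIV. if x = z then y x else 1)"
    by (intro prod.cong) (auto simp: indet_def lookup_single when_def)
  then show ?thesis by (simp add: monomial_of_def subst_single const_1)
qed

lemma subst_monomial_of: "subst (\<lambda>x. monomial_of (indet x)) f = f"
proof -
  have pow: "monomial_of (indet x) ^ m = (monomial_of (Poly_Mapping.single x m) :: ('a, 'b) mpoly)"
    for x :: 'a and m
    by (induction m) (simp_all add: monomial_of_def indet_def mult_single flip: single_add)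
  have prd: "(\<Prod>x\<in>A. monomial_of (h x)) = (monomial_of (sum h A) :: ('a, 'b) mpoly)"
    for h :: "'a \<Rightarrow> 'a pp" and A
    by (induction A rule: infinite_finite_induct) (simp_all add: monomial_of_def mult_single)
  have sm: "(\<Sum>x\<in>UNIV. Poly_Mapping.single x (Poly_Mapping.lookup t x)) = t" for t :: "'a pp"
    by (intro poly_mapping_eqI) (simp add: lookup_sum lookup_single when_def)
  show ?thesis
  proof (induction f rule: mpoly_induct)
    case (add t c f)
    then show ?case
      by (simp add: subst_add subst_single pow prd sm) (simp add: const_def monomial_of_def mult_single)
  qed simp
qed

section \<open>Term orderings and division\<close>

text \<open>As in \<^const>\<open>term_ordering\<close>, \<open>(s, t) \<in> \<sigma>\<close> reads ``\<open>s\<close> is at most \<open>t\<close>''.\<close>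

locale term_order =
  fixes \<sigma> :: "'n::finite pp rel"
  assumes term_ordering: "term_ordering \<sigma>"
begin

lemma ord_refl: "(t, t) \<in> \<sigma>"
  using term_ordering by (auto simp: term_ordering_def order_on_defs refl_on_def)

lemma ord_trans: "(s, t) \<in> \<sigma> \<Longrightarrow> (t, u) \<in> \<sigma> \<Longrightarrow> (s, u) \<in> \<sigma>"
  using term_ordering unfolding term_ordering_def order_on_defs by (meson transD)

lemma ord_antisym: "(s, t) \<in> \<sigma> \<Longrightarrow> (t, s) \<in> \<sigma> \<Longrightarrow> s = t"
  using term_ordering unfolding term_ordering_def order_on_defs by (meson antisymD)

lemma ord_total: "(s, t) \<in> \<sigma> \<or> (t, s) \<in> \<sigma>"
  using term_ordering ord_refl[of s]
  by (cases "s = t") (auto simp: term_ordering_def order_on_defs total_on_def)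

lemma ord_wf: "wf (\<sigma> - Id)"
  using term_ordering by (auto simp: term_ordering_def order_on_defs)

lemma ord_add: "(s, t) \<in> \<sigma> \<Longrightarrow> (u + s, u + t) \<in> \<sigma>"
  using term_ordering unfolding term_ordering_def by (metis add.commute)

lemma ord_zero: "(0, t) \<in> \<sigma>"
proof -
  obtain m where m: "(m, u) \<in> \<sigma>" for u
  proof -
    obtain m where "\<And>u. (u, m) \<in> \<sigma> - Id \<Longrightarrow> u \<notin> UNIV"
      using ord_wf[unfolded wf_eq_minimal] by (metis UNIV_I)
    then show ?thesis using that[of m] ord_total ord_refl by (metis DiffI UNIV_I pair_in_Id_conv)
  qed
  \<comment> \<open>The least term \<open>m\<close> satisfies \<open>m + m \<le> 0 + m\<close>, hence \<open>m = 0\<close>.\<close>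
  have "(m + m, m) \<in> \<sigma>" using ord_add[OF m[of 0], of m] by simp
  then have "m + m = m" using m ord_antisym by blast
  then show ?thesis using m[of t] by simp
qed

lemma ord_dvd: "pp_dvd s t \<Longrightarrow> (s, t) \<in> \<sigma>"
  using ord_add[OF ord_zero] by (auto simp: pp_dvd_def)

lemma LT_eqI: "t \<in> Poly_Mapping.keys f \<Longrightarrow> (\<And>u. u \<in> Poly_Mapping.keys f \<Longrightarrow> (u, t) \<in> \<sigma>) \<Longrightarrow> LT \<sigma> f = t"
  unfolding LT_def by (rule the_equality) (auto intro: ord_antisym)

lemma finite_has_ord_maximum:
  assumes "finite A" "A \<noteq> {}"
  shows "\<exists>t\<in>A. \<forall>u\<in>A. (u, t) \<in> \<sigma>"
  using assms
proof (induction rule: finite_ne_induct)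
  case (insert x A)
  then obtain t where t: "t \<in> A" "\<forall>u\<in>A. (u, t) \<in> \<sigma>" by blast
  show ?case
  proof (cases "(x, t) \<in> \<sigma>")
    case False
    then have "(t, x) \<in> \<sigma>" using ord_total by blast
    then show ?thesis using t ord_trans ord_refl by blast
  qed (use t in blast)
qed (simp add: ord_refl)

lemma
  assumes "f \<noteq> 0"
  shows LT_in_keys: "LT \<sigma> f \<in> Poly_Mapping.keys f"
    and LT_max: "u \<in> Poly_Mapping.keys f \<Longrightarrow> (u, LT \<sigma> f) \<in> \<sigma>"
proof -
  have "Poly_Mapping.keys f \<noteq> {}" using assms by simp
  then obtain t where t: "t \<in> Poly_Mapping.keys f" "\<forall>u\<in>Poly_Mapping.keys f. (u, t) \<in> \<sigma>"
    using finite_has_ord_maximum[of "Poly_Mapping.keys f"] by auto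
  then have "LT \<sigma> f = t" by (intro LT_eqI) auto
  then show "LT \<sigma> f \<in> Poly_Mapping.keys f"
    and "u \<in> Poly_Mapping.keys f \<Longrightarrow> (u, LT \<sigma> f) \<in> \<sigma>" using t by auto
qed

lemma LC_nonzero: "f \<noteq> 0 \<Longrightarrow> LC \<sigma> f \<noteq> 0"
  using LT_in_keys by (auto simp: LC_def in_keys_iff)

lemma keys_make_monic: "f \<noteq> 0 \<Longrightarrow> Poly_Mapping.keys (make_monic \<sigma> f) = Poly_Mapping.keys f"
  unfolding make_monic_def using LC_nonzero by (intro keys_const_mult) auto

lemma LT_make_monic: "f \<noteq> 0 \<Longrightarrow> LT \<sigma> (make_monic \<sigma> f) = LT \<sigma> f"
  by (simp add: LT_def keys_make_monic)

lemma LC_make_monic: "f \<noteq> 0 \<Longrightarrow> LC \<sigma> (make_monic \<sigma> f) = 1"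
  unfolding LC_def LT_make_monic
  using LC_nonzero by (simp add: make_monic_def lookup_const_mult LC_def)

text \<open>
  The polynomial \<open>f\<close> is a combination of the polynomials \<open>gs\<close> plus a remainder none of whose
  terms is divisible by the leading term of a divisor, and all terms of the summands are at most
  \<open>t\<close>. Unlike a bound by the leading term of \<open>f\<close>, a bound by a fixed \<open>t\<close> is compatible with
  addition, so the division algorithm can be run on single monomials.
\<close>

definition divisible_within :: "('n, 'k::field) mpoly list \<Rightarrow> 'n pp \<Rightarrow> ('n, 'k) mpoly \<Rightarrow> bool" where
  "divisible_within gs t f \<longleftrightarrow>
     (\<exists>q r. f = (\<Sum>j<length gs. q j * gs ! j) + r \<and>
        (\<forall>j<length gs. \<forall>k\<in>Poly_Mapping.keys (q j * gs ! j). (k, t) \<in> \<sigma>) \<and>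
        (\<forall>k\<in>Poly_Mapping.keys r. (k, t) \<in> \<sigma> \<and> (\<forall>g\<in>set gs. g \<noteq> 0 \<longrightarrow> \<not> pp_dvd (LT \<sigma> g) k)))"

lemma divisible_within_add:
  assumes "divisible_within gs t f" "divisible_within gs t g"
  shows "divisible_within gs t (f + g)"
proof -
  obtain q r where f: "f = (\<Sum>j<length gs. q j * gs ! j) + r"
    "\<forall>j<length gs. \<forall>k\<in>Poly_Mapping.keys (q j * gs ! j). (k, t) \<in> \<sigma>"
    "\<forall>k\<in>Poly_Mapping.keys r. (k, t) \<in> \<sigma> \<and> (\<forall>g\<in>set gs. g \<noteq> 0 \<longrightarrow> \<not> pp_dvd (LT \<sigma> g) k)"
    using assms(1) unfolding divisible_within_def by blast
  obtain q' r' where g: "g = (\<Sum>j<length gs. q' j * gs ! j) + r'"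
    "\<forall>j<length gs. \<forall>k\<in>Poly_Mapping.keys (q' j * gs ! j). (k, t) \<in> \<sigma>"
    "\<forall>k\<in>Poly_Mapping.keys r'. (k, t) \<in> \<sigma> \<and> (\<forall>g\<in>set gs. g \<noteq> 0 \<longrightarrow> \<not> pp_dvd (LT \<sigma> g) k)"
    using assms(2) unfolding divisible_within_def by blast
  have "f + g = (\<Sum>j<length gs. (q j + q' j) * gs ! j) + (r + r')"
    by (simp add: f(1) g(1) distrib_right sum.distrib)
  moreover have "\<forall>j<length gs. \<forall>k\<in>Poly_Mapping.keys ((q j + q' j) * gs ! j). (k, t) \<in> \<sigma>"
  proof (intro allI impI ballI)
    fix j k assume "j < length gs" "k \<in> Poly_Mapping.keys ((q j + q' j) * gs ! j)"
    then show "(k, t) \<in> \<sigma>"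
      using f(2) g(2) keys_add_cases[of k "q j * gs ! j" "q' j * gs ! j"] by (auto simp: distrib_right)
  qed
  moreover have "\<forall>k\<in>Poly_Mapping.keys (r + r'). (k, t) \<in> \<sigma> \<and>
      (\<forall>g\<in>set gs. g \<noteq> 0 \<longrightarrow> \<not> pp_dvd (LT \<sigma> g) k)"
    using f(3) g(3) keys_add_cases[of _ r r'] by blast
  ultimately show ?thesis
    unfolding divisible_within_def
    by (intro exI[of _ "\<lambda>j. q j + q' j"] exI[of _ "r + r'"]) simp
qed

lemma divisible_within_zero: "divisible_within gs t 0"
  unfolding divisible_within_def by (intro exI[of _ "\<lambda>_. 0"] exI[of _ 0]) simp

lemma divisible_within_singles:
  assumes "\<And>k. k \<in> Poly_Mapping.keys f \<Longrightarrow>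
    divisible_within gs t (Poly_Mapping.single k (Poly_Mapping.lookup f k))"
  shows "divisible_within gs t f"
proof -
  have "divisible_within gs t (\<Sum>k\<in>A. Poly_Mapping.single k (Poly_Mapping.lookup f k))"
    if "A \<subseteq> Poly_Mapping.keys f" for A
    using finite_subset[OF that finite_keys] that
    by (induction A rule: finite_induct)
      (auto intro!: divisible_within_add divisible_within_zero assms)
  moreover have "(\<Sum>k\<in>Poly_Mapping.keys f. Poly_Mapping.single k (Poly_Mapping.lookup f k)) = f"
    by (intro poly_mapping_eqI) (auto simp: lookup_sum lookup_single when_def in_keys_iff)
  ultimately show ?thesis by force
qed

lemma divisible_within_mono:
  assumes "divisible_within gs t f" "(t, u) \<in> \<sigma>"
  shows "divisible_within gs u f"
proof -
  obtain q r where *: "f = (\<Sum>j<length gs. q j * gs ! j) + r"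
    "\<forall>j<length gs. \<forall>k\<in>Poly_Mapping.keys (q j * gs ! j). (k, t) \<in> \<sigma>"
    "\<forall>k\<in>Poly_Mapping.keys r. (k, t) \<in> \<sigma> \<and> (\<forall>g\<in>set gs. g \<noteq> 0 \<longrightarrow> \<not> pp_dvd (LT \<sigma> g) k)"
    using assms(1) unfolding divisible_within_def by blast
  have le: "(k, u) \<in> \<sigma>" if "(k, t) \<in> \<sigma>" for k using that assms(2) by (rule ord_trans)
  show ?thesis
    unfolding divisible_within_def
    by (intro exI[of _ q] exI[of _ r] conjI) (use * le in auto)
qed

lemma divisible_within_single: "divisible_within gs t (Poly_Mapping.single t a)"
proof (induction t arbitrary: a rule: wf_induct_rule[OF ord_wf])
  case (1 t)
  show ?case
  proof (cases "\<exists>g\<in>set gs. g \<noteq> 0 \<and> pp_dvd (LT \<sigma> g) t")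
    case False
    then show ?thesis
      unfolding divisible_within_def
      by (intro exI[of _ "\<lambda>_. 0"] exI[of _ "Poly_Mapping.single t a"]) (auto simp: ord_refl)
  next
    case True
    then obtain i where i: "i < length gs" "gs ! i \<noteq> 0" "pp_dvd (LT \<sigma> (gs ! i)) t"
      by (auto simp: in_set_conv_nth)
    obtain u where t: "t = u + LT \<sigma> (gs ! i)"
      using i(3) unfolding pp_dvd_def by (metis add.commute)
    define m where "m = Poly_Mapping.single u (a / LC \<sigma> (gs ! i))"
    define h where "h = Poly_Mapping.single t a - m * gs ! i"
    have m_keys: "(k, t) \<in> \<sigma>" if k: "k \<in> Poly_Mapping.keys (m * gs ! i)" for k
    proof -
      obtain l where "l \<in> Poly_Mapping.keys (gs ! i)" "k = u + l"
        using k unfolding m_def by (rule keys_single_mult)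
      then show ?thesis unfolding t using LT_max[OF i(2)] ord_add by blast
    qed
    have "Poly_Mapping.lookup (m * gs ! i) t = a"
      unfolding t m_def lookup_single_mult using LC_nonzero[OF i(2)] by (simp add: LC_def)
    then have "t \<notin> Poly_Mapping.keys h" by (simp add: h_def in_keys_iff lookup_minus)
    moreover have "(k, t) \<in> \<sigma>" if k: "k \<in> Poly_Mapping.keys h" for k
      using keys_diff_cases[OF k[unfolded h_def]] m_keys ord_refl by (auto split: if_splits)
    ultimately have h: "(k, t) \<in> \<sigma> - Id" if "k \<in> Poly_Mapping.keys h" for k
      using that by auto
    have "divisible_within gs t h"
    proof (rule divisible_within_singles)
      fix k assume "k \<in> Poly_Mapping.keys h"
      then have k: "(k, t) \<in> \<sigma> - Id" by (rule h)
      then have "(k, t) \<in> \<sigma>" by blast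
      with "1.IH"[OF k] show "divisible_within gs t (Poly_Mapping.single k (Poly_Mapping.lookup h k))"
        by (rule divisible_within_mono)
    qed
    moreover have "divisible_within gs t (m * gs ! i)"
    proof -
      have "m * gs ! i = (\<Sum>j<length gs. (if j = i then m else 0) * gs ! j) + 0"
        using i(1) by (simp add: if_distrib[of "\<lambda>x. x * _"] cong: if_cong)
      then show ?thesis
        unfolding divisible_within_def
        by (intro exI[of _ "\<lambda>j. if j = i then m else 0"] exI[of _ 0] conjI)
          (use m_keys in \<open>auto split: if_splits\<close>)
    qed
    ultimately have "divisible_within gs t (h + m * gs ! i)" by (rule divisible_within_add)
    then show ?thesis by (simp add: h_def)
  qed
qed

lemma division:
  assumes "\<And>k. k \<in> Poly_Mapping.keys f \<Longrightarrow> (k, t) \<in> \<sigma>"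
  shows "divisible_within gs t f"
  by (rule divisible_within_singles) (rule divisible_within_mono[OF divisible_within_single assms])

lemma remainder_exists:
  assumes "f \<noteq> 0"
  shows "\<exists>r. is_remainder \<sigma> f gs r"
proof -
  have "divisible_within gs (LT \<sigma> f) f" using LT_max[OF assms] by (rule division)
  then obtain q r where *: "f = (\<Sum>j<length gs. q j * gs ! j) + r"
    "\<forall>j<length gs. \<forall>k\<in>Poly_Mapping.keys (q j * gs ! j). (k, LT \<sigma> f) \<in> \<sigma>"
    "\<forall>k\<in>Poly_Mapping.keys r. (k, LT \<sigma> f) \<in> \<sigma> \<and> (\<forall>g\<in>set gs. g \<noteq> 0 \<longrightarrow> \<not> pp_dvd (LT \<sigma> g) k)"
    unfolding divisible_within_def by blast
  then have "\<forall>j<length gs. q j * gs ! j \<noteq> 0 \<longrightarrow> f \<noteq> 0 \<and> (LT \<sigma> (q j * gs ! j), LT \<sigma> f) \<in> \<sigma>"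
    using assms LT_in_keys by blast
  with * show ?thesis unfolding is_remainder_def by blast
qed

text \<open>
  Modulo an ideal in which every \<open>z \<in> Z\<close> is a leading term, each polynomial is congruent to one
  that is free of \<open>Z\<close> and whose terms are bounded by terms of the given polynomial.
\<close>

lemma normal_form:
  fixes B :: "('n, 'k::field) mpoly set"
  assumes "\<And>z. z \<in> Z \<Longrightarrow> \<exists>g\<in>ideal_gen B - {0}. LT \<sigma> g = indet z"
  shows "\<exists>r. f - r \<in> ideal_gen B \<and> r \<in> polys_in (- Z) \<and>
    (\<forall>k\<in>Poly_Mapping.keys r. \<exists>l\<in>Poly_Mapping.keys f. (k, l) \<in> \<sigma>)"
proof (cases "f = 0")
  case True
  then show ?thesis
    by (intro exI[of _ 0]) (simp add: polys_in_def module.span_zero[OF module_mult] ideal_gen_def)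
next
  case False
  obtain g where g: "\<And>z. z \<in> Z \<Longrightarrow> g z \<in> ideal_gen B - {0} \<and> LT \<sigma> (g z) = indet z"
    using assms by metis
  obtain zs where zs: "set zs = Z" using finite_list[of Z] by auto
  let ?gs = "map g zs"
  have "divisible_within ?gs (LT \<sigma> f) f" using LT_max[OF False] by (rule division)
  then obtain q r where *: "f = (\<Sum>j<length ?gs. q j * ?gs ! j) + r"
    "\<forall>k\<in>Poly_Mapping.keys r. (k, LT \<sigma> f) \<in> \<sigma> \<and> (\<forall>g\<in>set ?gs. g \<noteq> 0 \<longrightarrow> \<not> pp_dvd (LT \<sigma> g) k)"
    unfolding divisible_within_def by blast
  have "?gs ! j \<in> ideal_gen B" if "j < length ?gs" for j using that g zs by auto
  then have "(\<Sum>j<length ?gs. q j * ?gs ! j) \<in> ideal_gen B"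
    by (intro ideal_gen_sum ideal_gen_mult) simp
  then have "f - r \<in> ideal_gen B" using *(1) by (simp only: add_diff_cancel_right')
  moreover have "r \<in> polys_in (- Z)"
    using *(2) g zs by (fastforce simp: polys_in_def pp_dvd_indet_iff)
  ultimately show ?thesis using *(2) LT_in_keys[OF False] by blast
qed

lemma LT_mult:
  fixes f g :: "('n, 'k::field) mpoly"
  assumes "f \<noteq> 0" "g \<noteq> 0"
  shows "LT \<sigma> (f * g) = LT \<sigma> f + LT \<sigma> g"
proof (rule LT_eqI)
  define h where "h = f - Poly_Mapping.single (LT \<sigma> f) (LC \<sigma> f)"
  have h: "k \<in> Poly_Mapping.keys f \<and> k \<noteq> LT \<sigma> f" if "k \<in> Poly_Mapping.keys h" for k
    using that by (auto simp: h_def in_keys_iff lookup_minus lookup_single when_def LC_def split: if_splits)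
  have "LT \<sigma> f + LT \<sigma> g \<notin> Poly_Mapping.keys (h * g)"
  proof
    assume "LT \<sigma> f + LT \<sigma> g \<in> Poly_Mapping.keys (h * g)"
    then obtain a b where ab: "LT \<sigma> f + LT \<sigma> g = a + b" "a \<in> Poly_Mapping.keys h" "b \<in> Poly_Mapping.keys g"
      using keys_mult[of h g] by blast
    have "(LT \<sigma> g + a, LT \<sigma> g + LT \<sigma> f) \<in> \<sigma>" using h[OF ab(2)] LT_max[OF assms(1)] ord_add by blast
    moreover have "(a + b, a + LT \<sigma> g) \<in> \<sigma>" using ab(3) LT_max[OF assms(2)] ord_add by blast
    ultimately have "a + LT \<sigma> g = LT \<sigma> f + LT \<sigma> g"
      using ord_antisym[of "a + LT \<sigma> g" "a + b"] ab(1) by (simp add: add.commute)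
    then show False using h[OF ab(2)] by simp
  qed
  then have "Poly_Mapping.lookup (f * g) (LT \<sigma> f + LT \<sigma> g) = LC \<sigma> f * LC \<sigma> g"
    using lookup_single_mult[of "LT \<sigma> f" "LC \<sigma> f" g "LT \<sigma> g"]
    by (simp add: h_def left_diff_distrib lookup_minus in_keys_iff LC_def[of _ g])
  then show "LT \<sigma> f + LT \<sigma> g \<in> Poly_Mapping.keys (f * g)"
    using LC_nonzero[OF assms(1)] LC_nonzero[OF assms(2)] by (simp add: in_keys_iff)
next
  fix u assume "u \<in> Poly_Mapping.keys (f * g)"
  then obtain a b where ab: "u = a + b" "a \<in> Poly_Mapping.keys f" "b \<in> Poly_Mapping.keys g"
    using keys_mult[of f g] by blast
  have "(LT \<sigma> g + a, LT \<sigma> g + LT \<sigma> f) \<in> \<sigma>" using ab LT_max[OF assms(1)] ord_add by blast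
  moreover have "(a + b, a + LT \<sigma> g) \<in> \<sigma>" using ab(3) LT_max[OF assms(2)] ord_add by blast
  ultimately show "(u, LT \<sigma> f + LT \<sigma> g) \<in> \<sigma>" using ab(1) ord_trans by (simp add: add.commute)
qed

lemma LT_indet_separating:
  assumes "f \<noteq> 0" "LT \<sigma> f = indet z"
  shows "separating_poly z f"
  unfolding separating_poly_def
proof (intro conjI ballI notI)
  show "indet z \<in> Poly_Mapping.keys f" using LT_in_keys[OF assms(1)] assms(2) by simp
next
  fix t assume t: "t \<in> Poly_Mapping.keys f - {indet z}" "pp_dvd (indet z) t"
  then have "(t, indet z) \<in> \<sigma>" using LT_max[OF assms(1)] assms(2) by auto
  with ord_dvd[OF t(2)] t(1) show False using ord_antisym by blast
qed

section \<open>Ideals whose leading terms are generated by indeterminates\<close>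

text \<open>
  An ideal generated by polynomials with leading terms \<open>z \<in> Z\<close>, one for each \<open>z\<close>, contains no
  nonzero polynomial free of \<open>Z\<close>.
\<close>

lemma triangular_elimination:
  fixes F :: "'n \<Rightarrow> ('n, 'k::field) mpoly"
  assumes F: "\<And>z. z \<in> Z \<Longrightarrow> F z \<noteq> 0 \<and> LT \<sigma> (F z) = indet z"
    and f: "f \<in> ideal_gen (F ` Z)" "f \<in> polys_in (- Z)"
  shows "f = 0"
proof -
  define tl where "tl z = monomial_of (indet z) - make_monic \<sigma> (F z)" for z
  define R where "R = inv_image (\<sigma> - Id) (indet :: 'n \<Rightarrow> 'n pp)"
  \<comment> \<open>The tail of \<open>F z\<close> contains only indeterminates below \<open>z\<close>, so the equations \<open>y z = subst y (tl z)\<close>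
    can be solved by well-founded recursion.\<close>
  define y where "y = wfrec R (\<lambda>y x. if x \<in> Z then subst y (tl x) else monomial_of (indet x))"
  have wf: "wf R" unfolding R_def using ord_wf by (rule wf_inv_image)
  have tl: "(x, z) \<in> R" if z: "z \<in> Z" and t: "t \<in> Poly_Mapping.keys (tl z)" and x: "x \<in> Poly_Mapping.keys t"
    for t x z
  proof -
    have F0: "F z \<noteq> 0" and LTz: "LT \<sigma> (F z) = indet z" using F[OF z] by auto
    have "Poly_Mapping.lookup (make_monic \<sigma> (F z)) (indet z) = 1"
      using LC_make_monic[OF F0] LTz unfolding LC_def LT_make_monic[OF F0] by simp
    then have "t \<noteq> indet z"
      using t by (auto simp: tl_def in_keys_iff lookup_minus monomial_of_def)
    then have "t \<in> Poly_Mapping.keys (make_monic \<sigma> (F z))"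
      using keys_diff_cases[OF t[unfolded tl_def]] by (simp add: monomial_of_def)
    then have "(t, indet z) \<in> \<sigma>"
      using LT_max[OF F0] LTz keys_make_monic[OF F0] by simp
    moreover have "(indet x, t) \<in> \<sigma>" using x by (intro ord_dvd) (simp add: pp_dvd_indet_iff)
    ultimately show ?thesis
      using \<open>t \<noteq> indet z\<close> ord_trans ord_antisym unfolding R_def by auto
  qed
  have y_eq: "y x = (if x \<in> Z then subst y (tl x) else monomial_of (indet x))" for x
  proof -
    have "y x = (if x \<in> Z then subst (cut y R x) (tl x) else monomial_of (indet x))"
      unfolding y_def by (subst wfrec[OF wf]) simp
    moreover have "subst (cut y R x) (tl x) = subst y (tl x)" if "x \<in> Z"
      using tl[OF that] by (intro subst_cong) (simp add: cut_apply)
    ultimately show ?thesis by simp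
  qed
  have "y x \<in> polys_in (- Z)" for x
  proof (induction x rule: wf_induct_rule[OF wf])
    case (1 x)
    show ?case
    proof (cases "x \<in> Z")
      case True
      then show ?thesis
        using tl[OF True] 1 by (simp add: y_eq[of x] subst_in_polys_in)
    next
      case False
      then show ?thesis by (simp add: y_eq[of x]) (simp add: polys_in_def monomial_of_def)
    qed
  qed
  have kill: "subst y (F z) = 0" if z: "z \<in> Z" for z
  proof -
    have F0: "F z \<noteq> 0" using F[OF z] by auto
    have "monomial_of (indet z) = make_monic \<sigma> (F z) + tl z" by (simp add: tl_def)
    then have "y z = subst y (make_monic \<sigma> (F z)) + subst y (tl z)"
      by (metis subst_add subst_indet)
    then have "subst y (make_monic \<sigma> (F z)) = 0" using z by (simp add: y_eq[of z])
    moreover have "F z = const (LC \<sigma> (F z)) * make_monic \<sigma> (F z)"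
      using LC_nonzero[OF F0]
      by (intro poly_mapping_eqI) (simp add: make_monic_def lookup_const_mult)
    ultimately show ?thesis by (metis subst_mult mult_zero_right)
  qed
  have "ideal_gen (F ` Z) \<subseteq> {f. subst y f = 0}"
    by (rule ideal_gen_minimal) (auto simp: kill subst_add subst_mult)
  then have "subst y f = 0" using f(1) by blast
  moreover have "subst y f = subst (\<lambda>x. monomial_of (indet x)) f"
    using f(2) by (intro subst_cong) (auto simp: y_eq polys_in_def)
  ultimately show ?thesis by (simp add: subst_monomial_of)
qed

text \<open>
  Of the two conditions, the second one does not involve the term ordering; it is also necessary
  by the subsequent lemma.
\<close>

lemma LT_ideal_eqI:
  fixes B :: "('n, 'k::field) mpoly set"
  assumes Z: "\<And>z. z \<in> Z \<Longrightarrow> \<exists>g\<in>ideal_gen B - {0}. LT \<sigma> g = indet z"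
    and elim: "\<And>f. f \<in> ideal_gen B \<Longrightarrow> f \<in> polys_in (- Z) \<Longrightarrow> f = 0"
  shows "LT_ideal \<sigma> (ideal_gen B) = indet_ideal Z"
  unfolding LT_ideal_eq_indet_ideal_iff
proof (intro conjI ballI)
  fix f assume f: "f \<in> ideal_gen B - {0}"
  then have f0: "f \<noteq> 0" by simp
  show "\<exists>z\<in>Z. z \<in> Poly_Mapping.keys (LT \<sigma> f)"
  proof (rule ccontr)
    assume not: "\<not> ?thesis"
    define m where "m = Poly_Mapping.single (LT \<sigma> f) (LC \<sigma> f)"
    \<comment> \<open>Reducing only the tail of \<open>f\<close> leaves the leading monomial \<open>m\<close> untouched.\<close>
    obtain r where r: "(f - m) - r \<in> ideal_gen B" "r \<in> polys_in (- Z)"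
      "\<forall>k\<in>Poly_Mapping.keys r. \<exists>l\<in>Poly_Mapping.keys (f - m). (k, l) \<in> \<sigma>"
      using normal_form[OF Z, of Z "f - m"] by blast
    have "LT \<sigma> f \<notin> Poly_Mapping.keys r"
    proof
      assume "LT \<sigma> f \<in> Poly_Mapping.keys r"
      then obtain l where l: "l \<in> Poly_Mapping.keys (f - m)" "(LT \<sigma> f, l) \<in> \<sigma>" using r(3) by blast
      have l': "l \<noteq> LT \<sigma> f" using l(1) by (auto simp: m_def LC_def in_keys_iff lookup_minus)
      then have "l \<in> Poly_Mapping.keys f"
        using l(1) by (auto simp: m_def in_keys_iff lookup_minus lookup_single when_def)
      then show False using LT_max[OF f0] ord_antisym l(2) l' by blast
    qed
    then have "Poly_Mapping.lookup (m + r) (LT \<sigma> f) \<noteq> 0"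
      using LC_nonzero[OF f0] by (simp add: m_def lookup_add in_keys_iff)
    moreover have "m + r = f - ((f - m) - r)" by simp
    then have "m + r \<in> ideal_gen B" using f r(1) ideal_gen_diff by (metis DiffD1)
    moreover have "m \<in> polys_in (- Z)" using not by (auto simp: m_def polys_in_def split: if_splits)
    then have "m + r \<in> polys_in (- Z)" using r(2) by (rule polys_in_add)
    ultimately show False using elim by fastforce
  qed
qed (use Z in blast)

lemma LT_ideal_eqD:
  assumes "LT_ideal \<sigma> A = indet_ideal Z" "f \<in> A" "f \<in> polys_in (- Z)"
  shows "f = 0"
proof (rule ccontr)
  assume "f \<noteq> 0"
  then obtain z where "z \<in> Z" "z \<in> Poly_Mapping.keys (LT \<sigma> f)"
    using assms(1,2) unfolding LT_ideal_eq_indet_ideal_iff by blast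
  then show False using assms(3) LT_in_keys[OF \<open>f \<noteq> 0\<close>] by (auto simp: polys_in_def)
qed

end

text \<open>
  The polynomials of the form \<open>z - h\<close>, with \<open>h\<close> free of \<open>Z\<close>, are described through their supports.
  Below they are called reduced forms of \<open>z\<close> when they lie in the ideal under consideration.
\<close>

lemma monic_diff_indet_iff:
  fixes g :: "('n, 'k::field) mpoly"
  assumes "z \<in> Z"
  shows "g - monomial_of (indet z) \<in> polys_in (- Z) \<longleftrightarrow>
    Poly_Mapping.lookup g (indet z) = 1 \<and>
    (\<forall>t\<in>Poly_Mapping.keys g - {indet z}. Poly_Mapping.keys t \<inter> Z = {})"
    (is "?d \<in> _ \<longleftrightarrow> _")
proof -
  have l: "Poly_Mapping.lookup ?d t = Poly_Mapping.lookup g t - (if t = indet z then 1 else 0)" for t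
    by (simp add: lookup_minus monomial_of_def lookup_single when_def)
  show ?thesis
  proof (intro iffI conjI)
    assume d: "?d \<in> polys_in (- Z)"
    then have "indet z \<notin> Poly_Mapping.keys ?d" using assms by (force simp: polys_in_def)
    then show "Poly_Mapping.lookup g (indet z) = 1" using l[of "indet z"] by (simp add: in_keys_iff)
    have "t \<in> Poly_Mapping.keys ?d" if "t \<in> Poly_Mapping.keys g - {indet z}" for t
      using that l[of t] by (simp add: in_keys_iff)
    then show "\<forall>t\<in>Poly_Mapping.keys g - {indet z}. Poly_Mapping.keys t \<inter> Z = {}"
      using d by (fastforce simp: polys_in_def)
  next
    assume g: "Poly_Mapping.lookup g (indet z) = 1 \<and>
      (\<forall>t\<in>Poly_Mapping.keys g - {indet z}. Poly_Mapping.keys t \<inter> Z = {})"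
    have "t \<in> Poly_Mapping.keys g - {indet z}" if "t \<in> Poly_Mapping.keys ?d" for t
      using that l[of t] g by (auto simp: in_keys_iff split: if_splits)
    then show "?d \<in> polys_in (- Z)" using g by (auto simp: polys_in_def)
  qed
qed

lemma (in term_order) reduced_form_exists:
  fixes B :: "('n, 'k::field) mpoly set"
  assumes "LT_ideal \<sigma> (ideal_gen B) = indet_ideal Z"
  shows "\<exists>g\<in>ideal_gen B. g - monomial_of (indet z) \<in> polys_in (- Z)"
proof -
  have "\<exists>g\<in>ideal_gen B - {0}. LT \<sigma> g = indet z" if "z \<in> Z" for z
    using that assms unfolding LT_ideal_eq_indet_ideal_iff by blast
  then obtain r where "monomial_of (indet z) - r \<in> ideal_gen B" "r \<in> polys_in (- Z)"
    using normal_form by blast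
  moreover have "monomial_of (indet z) - r - monomial_of (indet z) = 0 - r" by simp
  ultimately show ?thesis using polys_in_diff[OF polys_in_zero] by metis
qed

lemma (in term_order) LT_reduced_form:
  assumes "LT_ideal \<sigma> I = indet_ideal Z" "z \<in> Z" "g \<in> I" "g - monomial_of (indet z) \<in> polys_in (- Z)"
  shows "LT \<sigma> g = indet z"
proof -
  have g: "Poly_Mapping.lookup g (indet z) = 1"
    "\<forall>t\<in>Poly_Mapping.keys g - {indet z}. Poly_Mapping.keys t \<inter> Z = {}"
    using assms(4) unfolding monic_diff_indet_iff[OF assms(2)] by auto
  then have g0: "g \<noteq> 0" by auto
  then have "\<exists>z\<in>Z. z \<in> Poly_Mapping.keys (LT \<sigma> g)"
    using assms(1,3) unfolding LT_ideal_eq_indet_ideal_iff by blast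
  then show ?thesis using g(2) LT_in_keys[OF g0] by blast
qed

lemma (in term_order) reduced_Groebner_basis_of_reduced_forms:
  assumes I: "LT_ideal \<sigma> I = indet_ideal (set zs)" and dist: "distinct zs" and len: "length gs = length zs"
    and gs: "\<And>i. i < length zs \<Longrightarrow> gs ! i \<in> I \<and> gs ! i - monomial_of (indet (zs ! i)) \<in> polys_in (- set zs)"
  shows "is_reduced_Groebner_basis \<sigma> I (set gs)"
proof -
  have LT_gs: "LT \<sigma> (gs ! i) = indet (zs ! i)"
    and l: "Poly_Mapping.lookup (gs ! i) (indet (zs ! i)) = 1"
    and k: "\<forall>t\<in>Poly_Mapping.keys (gs ! i) - {indet (zs ! i)}. Poly_Mapping.keys t \<inter> set zs = {}"
    if i: "i < length zs" for i
    using LT_reduced_form[OF I nth_mem[OF i]] gs[OF i] monic_diff_indet_iff[OF nth_mem[OF i]] by auto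
  have sub: "set gs \<subseteq> I - {0}"
  proof
    fix g assume "g \<in> set gs"
    then obtain i where "i < length zs" "g = gs ! i" using len by (metis in_set_conv_nth)
    then show "g \<in> I - {0}" using gs[of i] l[of i] by auto
  qed
  have "LT_ideal \<sigma> (set gs) = indet_ideal (set zs)"
    unfolding LT_ideal_eq_indet_ideal_iff
  proof (intro conjI ballI)
    fix f assume "f \<in> set gs - {0}"
    then obtain i where "i < length zs" "f = gs ! i" using len by (metis in_set_conv_nth DiffD1)
    then show "\<exists>z\<in>set zs. z \<in> Poly_Mapping.keys (LT \<sigma> f)" using LT_gs by auto
  next
    fix z assume "z \<in> set zs"
    then obtain i where "i < length zs" "z = zs ! i" by (metis in_set_conv_nth)
    then have "gs ! i \<in> set gs - {0}" "LT \<sigma> (gs ! i) = indet z"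
      using LT_gs[of i] l[of i] len by auto
    then show "\<exists>f\<in>set gs - {0}. LT \<sigma> f = indet z" by (rule bexI[rotated])
  qed
  moreover have "LC \<sigma> g = 1 \<and> (\<forall>h\<in>set gs - {g}. \<forall>t\<in>Poly_Mapping.keys g. \<not> pp_dvd (LT \<sigma> h) t)"
    if g: "g \<in> set gs" for g
  proof -
    obtain i where i: "i < length zs" "g = gs ! i" using g len by (auto simp: in_set_conv_nth)
    have "\<not> pp_dvd (LT \<sigma> h) t" if h: "h \<in> set gs - {g}" and t: "t \<in> Poly_Mapping.keys g" for h t
    proof -
      obtain j where j: "j < length zs" "h = gs ! j" using h len by (auto simp: in_set_conv_nth)
      show ?thesis
      proof (cases "t = indet (zs ! i)")
        case True
        have "zs ! j \<noteq> zs ! i" using h i j dist by (auto simp: nth_eq_iff_index_eq)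
        then show ?thesis using True LT_gs[OF j(1)] j(2) by (simp add: pp_dvd_indet_iff)
      next
        case False
        then have "Poly_Mapping.keys t \<inter> set zs = {}" using k[OF i(1)] t i(2) by blast
        then have "zs ! j \<notin> Poly_Mapping.keys t" using nth_mem[OF j(1)] by blast
        then show ?thesis using LT_gs[OF j(1)] j(2) by (simp add: pp_dvd_indet_iff)
      qed
    qed
    then show ?thesis using i LT_gs[OF i(1)] l[OF i(1)] by (auto simp: LC_def)
  qed
  ultimately show ?thesis
    using sub I unfolding is_reduced_Groebner_basis_def is_Groebner_basis_def by auto
qed

section \<open>Interreduction\<close>

lemma set_take_drop:
  assumes "i < length gs"
  shows "set (take i gs @ drop (Suc i) gs) = {gs ! j |j. j < length gs \<and> j \<noteq> i}"
proof (intro equalityI subsetI)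
  fix x assume "x \<in> set (take i gs @ drop (Suc i) gs)"
  then show "x \<in> {gs ! j |j. j < length gs \<and> j \<noteq> i}"
  proof (simp, elim disjE)
    assume "x \<in> set (take i gs)"
    then obtain j where "j < i" "x = gs ! j" using assms by (auto simp: in_set_conv_nth)
    then show "\<exists>j. x = gs ! j \<and> j < length gs \<and> j \<noteq> i" using assms by auto
  next
    assume "x \<in> set (drop (Suc i) gs)"
    then obtain j where "j < length gs - Suc i" "x = gs ! (Suc i + j)"
      using assms by (auto simp: in_set_conv_nth)
    then show "\<exists>j. x = gs ! j \<and> j < length gs \<and> j \<noteq> i"
      by (intro exI[of _ "Suc i + j"]) auto
  qed
next
  fix x assume "x \<in> {gs ! j |j. j < length gs \<and> j \<noteq> i}"
  then obtain j where j: "j < length gs" "j \<noteq> i" "x = gs ! j" by blast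
  show "x \<in> set (take i gs @ drop (Suc i) gs)"
  proof (cases "j < i")
    case True
    then have "x \<in> set (take i gs)"
      using j by (auto simp: in_set_conv_nth intro!: exI[of _ j])
    then show ?thesis by simp
  next
    case False
    then have "x \<in> set (drop (Suc i) gs)"
      using j by (auto simp: in_set_conv_nth intro!: exI[of _ "j - Suc i"])
    then show ?thesis by simp
  qed
qed

context term_order
begin

text \<open>
  This is the invariant of interreduction: the \<open>i\<close>-th polynomial of \<open>gs\<close> is a monic element of \<open>I\<close>
  with leading term \<open>z\<^sub>i\<close>.
\<close>

definition monic_with_LT ::
    "'n list \<Rightarrow> ('n, 'k::field) mpoly set \<Rightarrow> ('n, 'k) mpoly list \<Rightarrow> bool" where
  "monic_with_LT zs I gs \<longleftrightarrow> length gs = length zs \<and>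
     (\<forall>i<length zs. gs ! i \<in> I \<and> gs ! i \<noteq> 0 \<and> LT \<sigma> (gs ! i) = indet (zs ! i) \<and> LC \<sigma> (gs ! i) = 1)"

lemma reducible_at_iff:
  assumes "monic_with_LT zs I gs"
  shows "reducible_at \<sigma> gs i \<longleftrightarrow>
    (\<exists>t\<in>Poly_Mapping.keys (gs ! i). \<exists>j<length zs. j \<noteq> i \<and> zs ! j \<in> Poly_Mapping.keys t)"
proof -
  have
    "gs ! j \<noteq> 0 \<and> pp_dvd (LT \<sigma> (gs ! j)) t \<longleftrightarrow> zs ! j \<in> Poly_Mapping.keys t" if "j < length zs" for j t
    using assms that by (auto simp: monic_with_LT_def pp_dvd_indet_iff)
  moreover have "length gs = length zs" using assms by (simp add: monic_with_LT_def)
  ultimately show ?thesis unfolding reducible_at_def by (metis (no_types, lifting))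
qed

text \<open>
  The set of indices at which the list is reducible shrinks strictly: the reduced polynomial becomes
  irreducible, and the reducibility of the other ones only depends on their own terms and on the
  leading terms, which do not change.
\<close>

lemma interreduction_step_invariant:
  fixes gs gs' :: "('n, 'k::field) mpoly list"
  assumes dist: "distinct zs" and inv: "monic_with_LT zs (ideal_gen B) gs"
    and step: "interreduction_step \<sigma> gs gs'"
  shows "monic_with_LT zs (ideal_gen B) gs'"
    and "{i. i < length zs \<and> reducible_at \<sigma> gs' i} \<subset> {i. i < length zs \<and> reducible_at \<sigma> gs i}"
proof -
  have len: "length gs = length zs" using inv by (simp add: monic_with_LT_def)
  have gs: "gs ! j \<in> ideal_gen B" "gs ! j \<noteq> 0" "LT \<sigma> (gs ! j) = indet (zs ! j)" "LC \<sigma> (gs ! j) = 1"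
    if "j < length zs" for j using inv that by (auto simp: monic_with_LT_def)
  obtain i r where i: "i < length zs" and red: "reducible_at \<sigma> gs i"
    and rem: "is_remainder \<sigma> (gs ! i) (take i gs @ drop (Suc i) gs) r" and gs': "gs' = gs[i := r]"
    using step len unfolding interreduction_step_def by auto
  define L where "L = take i gs @ drop (Suc i) gs"
  have set_L: "set L = {gs ! j |j. j < length zs \<and> j \<noteq> i}"
    unfolding L_def using set_take_drop[of i gs] i len by simp
  obtain q where q: "gs ! i = (\<Sum>j<length L. q j * L ! j) + r"
    and q_le: "\<forall>j<length L. q j * L ! j \<noteq> 0 \<longrightarrow> gs ! i \<noteq> 0 \<and> (LT \<sigma> (q j * L ! j), LT \<sigma> (gs ! i)) \<in> \<sigma>"
    and irr: "\<forall>t\<in>Poly_Mapping.keys r. \<forall>g\<in>set L. g \<noteq> 0 \<longrightarrow> \<not> pp_dvd (LT \<sigma> g) t"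
    using rem unfolding is_remainder_def L_def[symmetric] by blast
  have L: "\<exists>j'<length zs. j' \<noteq> i \<and> L ! j = gs ! j'" if "j < length L" for j
    using nth_mem[OF that] unfolding set_L by blast
  \<comment> \<open>The leading term of a summand is divisible by some \<open>z\<^sub>j\<close> with \<open>j \<noteq> i\<close>; so it is not \<open>z\<^sub>i\<close>
    and, being at most \<open>z\<^sub>i\<close>, it is smaller. Hence the leading term of \<open>gs ! i\<close> survives in \<open>r\<close>.\<close>
  have small: "(k, indet (zs ! i)) \<in> \<sigma> - Id"
    if j: "j < length L" and k: "k \<in> Poly_Mapping.keys (q j * L ! j)" for j k
  proof -
    obtain j' where j': "j' < length zs" "j' \<noteq> i" "L ! j = gs ! j'" using L[OF j] by blast
    have nz: "q j * L ! j \<noteq> 0" using k by auto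
    then have "q j \<noteq> 0" by auto
    then have "LT \<sigma> (q j * L ! j) = LT \<sigma> (q j) + indet (zs ! j')"
      using LT_mult gs[OF j'(1)] j'(3) by metis
    then have "zs ! j' \<in> Poly_Mapping.keys (LT \<sigma> (q j * L ! j))"
      by (simp add: in_keys_iff lookup_add indet_def)
    moreover have "zs ! j' \<noteq> zs ! i" using dist j' i by (simp add: nth_eq_iff_index_eq)
    ultimately have ne: "LT \<sigma> (q j * L ! j) \<noteq> indet (zs ! i)" by auto
    have le: "(LT \<sigma> (q j * L ! j), indet (zs ! i)) \<in> \<sigma>" using q_le j nz gs(3)[OF i] by simp
    have k_le: "(k, LT \<sigma> (q j * L ! j)) \<in> \<sigma>" using LT_max[OF nz k] .
    with le have "(k, indet (zs ! i)) \<in> \<sigma>" using ord_trans by blast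
    moreover have "k \<noteq> indet (zs ! i)" using k_le le ne ord_antisym by blast
    ultimately show ?thesis by simp
  qed
  define p where "p = (\<Sum>j<length L. q j * L ! j)"
  have p: "(k, indet (zs ! i)) \<in> \<sigma> - Id" if "k \<in> Poly_Mapping.keys p" for k
  proof -
    have "(\<Sum>j<length L. Poly_Mapping.lookup (q j * L ! j) k) \<noteq> 0"
      using that by (simp add: p_def in_keys_iff lookup_sum)
    then obtain j where "j \<in> {..<length L}" "Poly_Mapping.lookup (q j * L ! j) k \<noteq> 0"
      by (rule sum.not_neutral_contains_not_neutral)
    then show ?thesis using small[of j k] by (simp add: in_keys_iff)
  qed
  have r: "r = gs ! i - p" using q by (simp add: p_def)
  have "indet (zs ! i) \<notin> Poly_Mapping.keys p" using p by blast
  then have lookup_r: "Poly_Mapping.lookup r (indet (zs ! i)) = 1"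
    using gs(3,4)[OF i] by (simp add: r lookup_minus in_keys_iff LC_def)
  then have r0: "r \<noteq> 0" by auto
  have LT_r: "LT \<sigma> r = indet (zs ! i)"
  proof (rule LT_eqI)
    show "indet (zs ! i) \<in> Poly_Mapping.keys r" using lookup_r by (simp add: in_keys_iff)
    fix k assume "k \<in> Poly_Mapping.keys r"
    then show "(k, indet (zs ! i)) \<in> \<sigma>"
      using keys_diff_cases[of k "gs ! i" p] p LT_max[OF gs(2)[OF i]] gs(3)[OF i] unfolding r by auto
  qed
  have "p \<in> ideal_gen B"
    unfolding p_def
  proof (intro ideal_gen_sum ideal_gen_mult)
    fix j assume "j \<in> {..<length L}"
    then show "L ! j \<in> ideal_gen B" using L[of j] gs(1) by auto
  qed
  then have "r \<in> ideal_gen B" unfolding r using gs(1)[OF i] by (intro ideal_gen_diff)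
  then show inv': "monic_with_LT zs (ideal_gen B) gs'"
    using inv r0 LT_r lookup_r i
    unfolding monic_with_LT_def gs' by (auto simp: nth_list_update LC_def)
  have "\<not> reducible_at \<sigma> gs' i"
  proof -
    have "zs ! j \<notin> Poly_Mapping.keys t" if "t \<in> Poly_Mapping.keys r" "j < length zs" "j \<noteq> i" for t j
    proof -
      have "gs ! j \<in> set L" using that unfolding set_L by blast
      then show ?thesis using irr that(1) gs(2,3)[OF that(2)] by (metis pp_dvd_indet_iff)
    qed
    then show ?thesis unfolding reducible_at_iff[OF inv'] using i len by (auto simp: gs')
  qed
  moreover have "reducible_at \<sigma> gs' j \<longleftrightarrow> reducible_at \<sigma> gs j" if "j \<noteq> i" for j
    unfolding reducible_at_iff[OF inv'] reducible_at_iff[OF inv] using that by (simp add: gs')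
  ultimately have
    "{j. j < length zs \<and> reducible_at \<sigma> gs' j} \<subseteq> {j. j < length zs \<and> reducible_at \<sigma> gs j} - {i}"
    by (metis (mono_tags, lifting) DiffI mem_Collect_eq singletonD subsetI)
  then show
    "{i. i < length zs \<and> reducible_at \<sigma> gs' i} \<subset> {i. i < length zs \<and> reducible_at \<sigma> gs i}"
    using i red by blast
qed

lemma interreduced_reduced_forms:
  assumes inv: "monic_with_LT zs I gs" and "interreduced \<sigma> gs" and i: "i < length zs"
  shows "gs ! i - monomial_of (indet (zs ! i)) \<in> polys_in (- set zs)"
  unfolding monic_diff_indet_iff[OF nth_mem[OF i]]
proof (intro conjI ballI)
  have gs: "gs ! i \<noteq> 0" "LT \<sigma> (gs ! i) = indet (zs ! i)" "LC \<sigma> (gs ! i) = 1"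
    using inv i by (auto simp: monic_with_LT_def)
  then show "Poly_Mapping.lookup (gs ! i) (indet (zs ! i)) = 1" by (simp add: LC_def)
  have not_red: "\<not> reducible_at \<sigma> gs i"
    using assms(2) inv i by (auto simp: interreduced_def monic_with_LT_def)
  fix t assume t: "t \<in> Poly_Mapping.keys (gs ! i) - {indet (zs ! i)}"
  have "zs ! j \<notin> Poly_Mapping.keys t" if "j < length zs" for j
  proof (cases "j = i")
    case True
    then show ?thesis
      using LT_indet_separating[OF gs(1,2)] t by (auto simp: separating_poly_def pp_dvd_indet_iff)
  next
    case False
    then show ?thesis using not_red that t unfolding reducible_at_iff[OF inv] by blast
  qed
  then show "Poly_Mapping.keys t \<inter> set zs = {}" by (auto simp: in_set_conv_nth)
qed

lemma interreduces_to_exists: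
  assumes dist: "distinct zs" and "monic_with_LT zs (ideal_gen B) gs"
  shows "\<exists>gs'. interreduces_to \<sigma> gs gs'"
  using assms(2)
proof (induction "card {i. i < length zs \<and> reducible_at \<sigma> gs i}" arbitrary: gs rule: less_induct)
  case less
  show ?case
  proof (cases "interreduced \<sigma> gs")
    case True
    then show ?thesis unfolding interreduces_to_def by blast
  next
    case False
    then obtain i where i: "i < length gs" "reducible_at \<sigma> gs i" unfolding interreduced_def by blast
    then have "gs ! i \<noteq> 0" using less.prems by (auto simp: monic_with_LT_def)
    then obtain r where "is_remainder \<sigma> (gs ! i) (take i gs @ drop (Suc i) gs) r"
      using remainder_exists by blast
    then have step: "interreduction_step \<sigma> gs (gs[i := r])"
      using i unfolding interreduction_step_def by blast
    note inv' = interreduction_step_invariant[OF dist less.prems step]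
    have "\<exists>gs'. interreduces_to \<sigma> (gs[i := r]) gs'"
      by (rule less.hyps[OF psubset_card_mono[OF _ inv'(2)] inv'(1)]) simp
    then show ?thesis
      using step unfolding interreduces_to_def by (meson converse_rtranclp_into_rtranclp)
  qed
qed

lemma interreduction_terminates:
  assumes dist: "distinct zs" and inv: "monic_with_LT zs (ideal_gen B) (S 0)"
    and S: "\<And>k. interreduction_step \<sigma> (S k) (S (Suc k))"
  shows False
proof -
  define m where "m k = card {i. i < length zs \<and> reducible_at \<sigma> (S k) i}" for k
  have invk: "monic_with_LT zs (ideal_gen B) (S k)" for k
  proof (induction k)
    case (Suc k)
    show ?case by (rule interreduction_step_invariant(1)[OF dist Suc S])
  qed (rule inv)
  have "m (Suc k) < m k" for k
    unfolding m_def
    by (rule psubset_card_mono[OF _ interreduction_step_invariant(2)[OF dist invk S]]) simp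
  then have dec: "Suc (m (Suc k)) \<le> m k" for k by (simp add: Suc_le_eq)
  have "m k + k \<le> m 0" for k
  proof (induction k)
    case (Suc k)
    then show ?case using dec[of k] by simp
  qed simp
  from this[of "Suc (m 0)"] show False by simp
qed

lemma interreduction_yields_reduced_Groebner_basis:
  assumes I: "LT_ideal \<sigma> (ideal_gen B) = indet_ideal (set zs)"
    and dist: "distinct zs" and inv: "monic_with_LT zs (ideal_gen B) gs"
  shows "\<exists>G. is_reduced_Groebner_basis \<sigma> (ideal_gen B) G \<and> interreduction_yields \<sigma> gs G"
proof -
  have final: "monic_with_LT zs (ideal_gen B) hs \<and>
      (\<forall>i<length zs. hs ! i - monomial_of (indet (zs ! i)) \<in> polys_in (- set zs))"
    if "interreduces_to \<sigma> gs hs" for hs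
  proof -
    from that have "(interreduction_step \<sigma>)\<^sup>*\<^sup>* gs hs" and red: "interreduced \<sigma> hs"
      by (auto simp: interreduces_to_def)
    from this(1) inv have "monic_with_LT zs (ideal_gen B) hs"
      by (induction rule: rtranclp_induct) (auto intro: interreduction_step_invariant(1)[OF dist])
    then show ?thesis using interreduced_reduced_forms red by blast
  qed
  obtain hs where hs: "interreduces_to \<sigma> gs hs" using interreduces_to_exists[OF dist inv] by blast
  have "is_reduced_Groebner_basis \<sigma> (ideal_gen B) (set hs)"
    using final[OF hs] by (intro reduced_Groebner_basis_of_reduced_forms[OF I dist]) (auto simp: monic_with_LT_def)
  \<comment> \<open>The difference of two reduced forms of \<open>z\<^sub>i\<close> lies in the ideal and is free of \<open>Z\<close>.\<close>
  moreover have "hs' = hs" if "interreduces_to \<sigma> gs hs'" for hs'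
  proof (rule nth_equalityI)
    show "length hs' = length hs" using final[OF hs] final[OF that] by (simp add: monic_with_LT_def)
    fix i assume "i < length hs'"
    then have i: "i < length zs" using final[OF that] by (simp add: monic_with_LT_def)
    have "hs' ! i - hs ! i \<in> ideal_gen B"
      using final[OF hs] final[OF that] i by (auto simp: monic_with_LT_def intro: ideal_gen_diff)
    moreover have "hs' ! i - hs ! i =
        (hs' ! i - monomial_of (indet (zs ! i))) - (hs ! i - monomial_of (indet (zs ! i)))" by simp
    then have "hs' ! i - hs ! i \<in> polys_in (- set zs)"
      using final[OF hs] final[OF that] i polys_in_diff by metis
    ultimately have "hs' ! i - hs ! i = 0" by (rule LT_ideal_eqD[OF I])
    then show "hs' ! i = hs ! i" by simp
  qed
  then have "interreduction_yields \<sigma> gs (set hs)"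
    unfolding interreduction_yields_def
    using hs interreduction_terminates[OF dist] inv by blast
  ultimately show ?thesis by blast
qed

end

section \<open>Lexicographic term orderings\<close>

text \<open>
  Exponents are compared at the first entry of \<open>xs\<close> where they differ. This is a
  term ordering if every indeterminate occurs in \<open>xs\<close>; repetitions are harmless.
\<close>

definition lex_ordering :: "'n list \<Rightarrow> 'n pp rel" where
  "lex_ordering xs = {(s, t). s = t \<or> (\<exists>i<length xs.
     (\<forall>j<i. Poly_Mapping.lookup s (xs ! j) = Poly_Mapping.lookup t (xs ! j)) \<and>
     Poly_Mapping.lookup s (xs ! i) < Poly_Mapping.lookup t (xs ! i))}"

lemma wf_lex_ordering: "wf (lex_ordering xs - Id)"
proof -
  have "lex_ordering xs - Id \<subseteq> inv_image (lenlex less_than) (\<lambda>t. map (Poly_Mapping.lookup t) xs)"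
  proof (rule subrelI)
    fix s t assume "(s, t) \<in> lex_ordering xs - Id"
    then obtain i where i: "i < length xs"
      "\<forall>j<i. Poly_Mapping.lookup s (xs ! j) = Poly_Mapping.lookup t (xs ! j)"
      "Poly_Mapping.lookup s (xs ! i) < Poly_Mapping.lookup t (xs ! i)"
      unfolding lex_ordering_def by auto
    define pre where "pre = map (Poly_Mapping.lookup s) (take i xs)"
    have pre: "pre = map (Poly_Mapping.lookup t) (take i xs)"
      unfolding pre_def using i(1,2) by (intro nth_equalityI) auto
    have split: "map f xs = map f (take i xs) @ f (xs ! i) # map f (drop (Suc i) xs)" for f :: "'a \<Rightarrow> nat"
      by (subst id_take_nth_drop[OF i(1)]) simp
    have "(map (Poly_Mapping.lookup s) xs, map (Poly_Mapping.lookup t) xs) \<in> lex less_than"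
      using split[of "Poly_Mapping.lookup s", folded pre_def] split[of "Poly_Mapping.lookup t", folded pre]
        i(3) unfolding lex_conv by fastforce
    then show "(s, t) \<in> inv_image (lenlex less_than) (\<lambda>t. map (Poly_Mapping.lookup t) xs)"
      by (simp add: lenlex_conv)
  qed
  then show ?thesis by (rule wf_subset[rotated]) (intro wf_inv_image wf_lenlex wf_less_than)
qed

lemma term_ordering_lex_ordering:
  assumes xs: "set xs = UNIV"
  shows "term_ordering (lex_ordering xs)"
proof -
  let ?r = "lex_ordering xs"
  have "trans ?r"
  proof (rule transI)
    fix s t u assume st: "(s, t) \<in> ?r" and tu: "(t, u) \<in> ?r"
    show "(s, u) \<in> ?r"
    proof (cases "s = t \<or> t = u")
      case False
      then obtain i k where i: "i < length xs"
        "\<forall>j<i. Poly_Mapping.lookup s (xs ! j) = Poly_Mapping.lookup t (xs ! j)"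
        "Poly_Mapping.lookup s (xs ! i) < Poly_Mapping.lookup t (xs ! i)"
        and k: "k < length xs"
        "\<forall>j<k. Poly_Mapping.lookup t (xs ! j) = Poly_Mapping.lookup u (xs ! j)"
        "Poly_Mapping.lookup t (xs ! k) < Poly_Mapping.lookup u (xs ! k)"
        using st tu unfolding lex_ordering_def by auto
      have "Poly_Mapping.lookup s (xs ! min i k) < Poly_Mapping.lookup u (xs ! min i k)"
        using i k by (cases i k rule: linorder_cases) auto
      then show ?thesis
        using i k unfolding lex_ordering_def by (auto intro!: exI[of _ "min i k"])
    qed (use st tu in auto)
  qed
  moreover have "antisym ?r"
  proof (rule antisymI, rule ccontr)
    fix s t assume st: "(s, t) \<in> ?r" "(t, s) \<in> ?r" "s \<noteq> t"
    then obtain i k where i: "i < length xs"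
        "\<forall>j<i. Poly_Mapping.lookup s (xs ! j) = Poly_Mapping.lookup t (xs ! j)"
        "Poly_Mapping.lookup s (xs ! i) < Poly_Mapping.lookup t (xs ! i)"
        and k: "k < length xs"
        "\<forall>j<k. Poly_Mapping.lookup t (xs ! j) = Poly_Mapping.lookup s (xs ! j)"
        "Poly_Mapping.lookup t (xs ! k) < Poly_Mapping.lookup s (xs ! k)"
        unfolding lex_ordering_def by auto
    then show False by (cases i k rule: linorder_cases) auto
  qed
  moreover have "total ?r"
  proof (rule total_onI)
    fix s t :: "'a pp" assume "s \<noteq> t"
    then obtain x where "Poly_Mapping.lookup s x \<noteq> Poly_Mapping.lookup t x"
      by (meson poly_mapping_eqI)
    moreover obtain i where "i < length xs" "xs ! i = x" using xs by (metis UNIV_I in_set_conv_nth)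
    ultimately have ex: "\<exists>i. i < length xs \<and> Poly_Mapping.lookup s (xs ! i) \<noteq> Poly_Mapping.lookup t (xs ! i)"
      by blast
    obtain k where k: "k < length xs" "Poly_Mapping.lookup s (xs ! k) \<noteq> Poly_Mapping.lookup t (xs ! k)"
      and least: "\<forall>j<k. \<not> (j < length xs \<and> Poly_Mapping.lookup s (xs ! j) \<noteq> Poly_Mapping.lookup t (xs ! j))"
      using exists_least_iff[THEN iffD1, OF ex] by blast
    have "\<forall>j<k. Poly_Mapping.lookup s (xs ! j) = Poly_Mapping.lookup t (xs ! j)"
      using least k(1) by auto
    moreover have "Poly_Mapping.lookup s (xs ! k) < Poly_Mapping.lookup t (xs ! k) \<or>
        Poly_Mapping.lookup t (xs ! k) < Poly_Mapping.lookup s (xs ! k)" using k(2) by linarith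
    ultimately show "(s, t) \<in> ?r \<or> (t, s) \<in> ?r"
      using k(1) unfolding lex_ordering_def by auto
  qed
  moreover have "(s + u, t + u) \<in> ?r" if "(s, t) \<in> ?r" for s t u
    using that unfolding lex_ordering_def by (auto simp: lookup_add)
  ultimately show ?thesis
    using wf_lex_ordering[of xs]
    by (simp add: term_ordering_def order_on_defs refl_on_def) (simp add: lex_ordering_def)
qed

text \<open>With \<open>Z\<close> listed first, every \<open>z \<in> Z\<close> exceeds all terms free of \<open>Z\<close>.\<close>

lemma elimination_term_ordering_exists:
  fixes zs :: "'n::finite list"
  shows "\<exists>\<sigma>. term_ordering \<sigma> \<and>
    (\<forall>z\<in>set zs. \<forall>t. Poly_Mapping.keys t \<inter> set zs = {} \<longrightarrow> (t, indet z) \<in> \<sigma>)"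
proof -
  obtain ys :: "'n list" where ys: "set ys = UNIV" using finite_list[OF finite] by blast
  show ?thesis
  proof (intro exI[of _ "lex_ordering (zs @ ys)"] conjI ballI allI impI)
    show "term_ordering (lex_ordering (zs @ ys))"
      by (rule term_ordering_lex_ordering) (simp add: ys)
    fix z and t :: "'n pp" assume z: "z \<in> set zs" and t: "Poly_Mapping.keys t \<inter> set zs = {}"
    have ex: "\<exists>i. i < length zs \<and> zs ! i = z" using z by (metis in_set_conv_nth)
    obtain i where i: "i < length zs" "zs ! i = z" and "\<forall>j<i. \<not> (j < length zs \<and> zs ! j = z)"
      using exists_least_iff[THEN iffD1, OF ex] by blast
    then have least: "zs ! j \<noteq> z" if "j < i" for j using that by auto
    have "Poly_Mapping.lookup t (zs ! j) = 0" if "j < length zs" for j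
      using t nth_mem[OF that] by (auto simp: in_keys_iff)
    moreover have "Poly_Mapping.lookup (indet z) (zs ! j) = 0" if "j < i" for j
      using least[OF that] by (simp add: indet_def lookup_single when_def)
    moreover have "Poly_Mapping.lookup (indet z) (zs ! i) = 1" using i by (simp add: indet_def)
    ultimately show "(t, indet z) \<in> lex_ordering (zs @ ys)"
      unfolding lex_ordering_def using i
      by (intro CollectI case_prodI disjI2 exI[of _ i]) (auto simp: nth_append)
  qed
qed

section \<open>Separating tuples and ideals\<close>

lemma separating_ordering_tuple_LT_ideal:
  fixes fs :: "('n::finite, 'k::field) mpoly list"
  assumes sep: "separating_ordering_tuple zs fs \<sigma>"
    and dist: "distinct zs" and len: "length fs = length zs" and nz: "\<And>i. i < length zs \<Longrightarrow> fs ! i \<noteq> 0"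
  shows "LT_ideal \<sigma> (ideal_gen (set fs)) = indet_ideal (set zs)"
proof -
  interpret term_order \<sigma>
    using sep by unfold_locales (simp add: separating_ordering_tuple_def)
  \<comment> \<open>\<open>F\<close> indexes the polynomials by their leading terms.\<close>
  define F where "F z = the (map_of (zip zs fs) z)" for z
  have F: "F (zs ! i) = fs ! i" if "i < length zs" for i
    using that dist len by (simp add: F_def map_of_zip_nth)
  have F_LT: "F z \<noteq> 0 \<and> LT \<sigma> (F z) = indet z" if "z \<in> set zs" for z
    using that F nz sep by (auto simp: in_set_conv_nth separating_ordering_tuple_def)
  have "fs = map F zs" using F len by (intro nth_equalityI) auto
  then have set_fs: "set fs = F ` set zs" by simp
  show ?thesis
  proof (rule LT_ideal_eqI)
    fix z assume z: "z \<in> set zs"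
    then have "F z \<in> ideal_gen (set fs)" unfolding set_fs by (intro ideal_gen_base imageI)
    then show "\<exists>g\<in>ideal_gen (set fs) - {0}. LT \<sigma> g = indet z" using F_LT[OF z] by blast
  next
    fix f assume "f \<in> ideal_gen (set fs)" "f \<in> polys_in (- set zs)"
    then show "f = 0" unfolding set_fs by (intro triangular_elimination[OF F_LT]) auto
  qed
qed

lemma coherently_separating_tupleD:
  fixes zs :: "'n::finite list" and fs :: "('n, 'k::field) mpoly list"
  assumes coh: "coherently_separating_tuple zs fs" and dist: "distinct zs"
    and len: "length fs = length zs" and nz: "\<And>i. i < length zs \<Longrightarrow> fs ! i \<noteq> 0"
    and ij: "i < length zs" "j < length zs" "j \<noteq> i" and t: "t \<in> Poly_Mapping.keys (fs ! j)"
  shows "\<not> pp_dvd (indet (zs ! i)) t"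
proof -
  obtain \<sigma> where sep: "separating_ordering_tuple zs fs \<sigma>"
    and red: "is_reduced_Groebner_basis \<sigma> (ideal_gen (set fs)) (make_monic \<sigma> ` set fs)"
    using coh unfolding coherently_separating_tuple_def by blast
  interpret term_order \<sigma>
    using sep by unfold_locales (simp add: separating_ordering_tuple_def)
  have LT_m: "LT \<sigma> (make_monic \<sigma> (fs ! k)) = indet (zs ! k)" if "k < length zs" for k
    using LT_make_monic[OF nz[OF that]] sep that by (simp add: separating_ordering_tuple_def)
  have "indet (zs ! i) \<noteq> indet (zs ! j)" using dist ij by (simp add: nth_eq_iff_index_eq)
  then have "make_monic \<sigma> (fs ! i) \<noteq> make_monic \<sigma> (fs ! j)" using LT_m ij by metis
  then have "make_monic \<sigma> (fs ! i) \<in> make_monic \<sigma> ` set fs - {make_monic \<sigma> (fs ! j)}"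
    using ij(1) len by simp
  moreover have "make_monic \<sigma> (fs ! j) \<in> make_monic \<sigma> ` set fs" using ij(2) len by simp
  moreover have "t \<in> Poly_Mapping.keys (make_monic \<sigma> (fs ! j))"
    using t keys_make_monic[OF nz[OF ij(2)]] by simp
  ultimately have "\<not> pp_dvd (LT \<sigma> (make_monic \<sigma> (fs ! i))) t"
    using red unfolding is_reduced_Groebner_basis_def by blast
  then show ?thesis using LT_m[OF ij(1)] by simp
qed

lemma coherently_separating_tupleI:
  fixes zs :: "'n::finite list" and fs :: "('n, 'k::field) mpoly list"
  assumes dist: "distinct zs" and len: "length fs = length zs"
    and sep: "\<And>i. i < length zs \<Longrightarrow> separating_poly (zs ! i) (fs ! i)"
    and other: "\<And>i j t. i < length zs \<Longrightarrow> j < length zs \<Longrightarrow> j \<noteq> i \<Longrightarrow>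
      t \<in> Poly_Mapping.keys (fs ! j) \<Longrightarrow> \<not> pp_dvd (indet (zs ! i)) t"
  shows "coherently_separating_tuple zs fs"
proof -
  obtain \<sigma> where \<sigma>: "term_ordering \<sigma>"
    "\<And>z t. z \<in> set zs \<Longrightarrow> Poly_Mapping.keys t \<inter> set zs = {} \<Longrightarrow> (t, indet z) \<in> \<sigma>"
    using elimination_term_ordering_exists[of zs] by blast
  interpret term_order \<sigma> using \<sigma>(1) by unfold_locales
  have no_z: "Poly_Mapping.keys t \<inter> set zs = {}"
    if i: "i < length zs" and t: "t \<in> Poly_Mapping.keys (fs ! i) - {indet (zs ! i)}" for i t
  proof -
    have "zs ! j \<notin> Poly_Mapping.keys t" if j: "j < length zs" for j
      using sep[OF i] other[OF j i, of t] t
      by (cases "j = i") (auto simp: separating_poly_def pp_dvd_indet_iff)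
    then show ?thesis by (auto simp: in_set_conv_nth)
  qed
  have nz: "fs ! i \<noteq> 0" if "i < length zs" for i
    using sep[OF that] by (auto simp: separating_poly_def)
  have LT_f: "LT \<sigma> (fs ! i) = indet (zs ! i)" if i: "i < length zs" for i
  proof (rule LT_eqI)
    show "indet (zs ! i) \<in> Poly_Mapping.keys (fs ! i)" using sep[OF i] by (simp add: separating_poly_def)
    fix u assume "u \<in> Poly_Mapping.keys (fs ! i)"
    then show "(u, indet (zs ! i)) \<in> \<sigma>"
      using ord_refl no_z[OF i, of u] \<sigma>(2)[OF nth_mem[OF i]] by (cases "u = indet (zs ! i)") auto
  qed
  have ord: "separating_ordering_tuple zs fs \<sigma>"
    using \<sigma>(1) LT_f by (simp add: separating_ordering_tuple_def)
  have "is_reduced_Groebner_basis \<sigma> (ideal_gen (set fs)) (set (map (make_monic \<sigma>) fs))"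
  proof (rule reduced_Groebner_basis_of_reduced_forms[OF _ dist])
    show "LT_ideal \<sigma> (ideal_gen (set fs)) = indet_ideal (set zs)"
      using ord dist len nz by (rule separating_ordering_tuple_LT_ideal)
    show "length (map (make_monic \<sigma>) fs) = length zs" by (simp add: len)
    fix i assume i: "i < length zs"
    have "make_monic \<sigma> (fs ! i) \<in> ideal_gen (set fs)"
      unfolding make_monic_def using i len by (intro ideal_gen_mult ideal_gen_base) simp
    moreover have "make_monic \<sigma> (fs ! i) - monomial_of (indet (zs ! i)) \<in> polys_in (- set zs)"
      unfolding monic_diff_indet_iff[OF nth_mem[OF i]] keys_make_monic[OF nz[OF i]]
      using LC_make_monic[OF nz[OF i]] LT_make_monic[OF nz[OF i]] LT_f[OF i] no_z[OF i]
      by (simp add: LC_def)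
    ultimately show "map (make_monic \<sigma>) fs ! i \<in> ideal_gen (set fs) \<and>
        map (make_monic \<sigma>) fs ! i - monomial_of (indet (zs ! i)) \<in> polys_in (- set zs)"
      using i len by simp
  qed
  then show ?thesis using ord unfolding coherently_separating_tuple_def by auto
qed

lemma SepD:
  assumes "\<sigma> \<in> Sep zs I"
  shows "term_order \<sigma>" and "LT_ideal \<sigma> I = indet_ideal (set zs)"
  using assms by (auto simp: Sep_def term_order_def)

lemma Sep_reduced_Groebner_basis_exists:
  fixes B :: "('n::finite, 'k::field) mpoly set"
  assumes \<sigma>: "\<sigma> \<in> Sep zs (ideal_gen B)" and dist: "distinct zs"
  shows "\<exists>gs. length gs = length zs \<and> is_reduced_Groebner_basis \<sigma> (ideal_gen B) (set gs) \<and>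
    (\<forall>i<length zs. LT \<sigma> (gs ! i) = indet (zs ! i))"
proof -
  interpret term_order \<sigma> using SepD(1)[OF \<sigma>] .
  note I = SepD(2)[OF \<sigma>]
  have "\<exists>g\<in>ideal_gen B. g - monomial_of (indet z) \<in> polys_in (- set zs)" for z
    using I by (rule reduced_form_exists)
  then obtain g where g: "\<And>z. g z \<in> ideal_gen B" "\<And>z. g z - monomial_of (indet z) \<in> polys_in (- set zs)"
    by metis
  have "is_reduced_Groebner_basis \<sigma> (ideal_gen B) (set (map g zs))"
    using g by (intro reduced_Groebner_basis_of_reduced_forms[OF I dist]) auto
  moreover have "\<forall>i<length zs. LT \<sigma> (map g zs ! i) = indet (zs ! i)"
    using LT_reduced_form[OF I _ g] by simp
  ultimately show ?thesis by (intro exI[of _ "map g zs"]) simp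
qed

lemma Sep_reduced_Groebner_basis_coherent:
  fixes B :: "('n::finite, 'k::field) mpoly set"
  assumes \<sigma>: "\<sigma> \<in> Sep zs (ideal_gen B)"
    and red: "is_reduced_Groebner_basis \<sigma> (ideal_gen B) (set gs)"
    and LT_gs: "\<forall>i<length zs. LT \<sigma> (gs ! i) = indet (zs ! i)"
  shows "coherently_separating_tuple zs gs"
proof -
  have gs: "set gs \<subseteq> ideal_gen B - {0}" "LT_ideal \<sigma> (set gs) = LT_ideal \<sigma> (ideal_gen B)"
    "\<And>g. g \<in> set gs \<Longrightarrow> LC \<sigma> g = 1"
    using red unfolding is_reduced_Groebner_basis_def is_Groebner_basis_def by auto
  \<comment> \<open>The ideal generated by \<open>gs\<close> lies between \<open>set gs\<close> and \<open>ideal_gen B\<close>, which have the same leading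
    term ideal; so there is no need to know that \<open>gs\<close> generates \<open>ideal_gen B\<close>.\<close>
  have sub: "set gs \<subseteq> ideal_gen (set gs)" by (auto intro: ideal_gen_base)
  have "ideal_gen (set gs) \<subseteq> ideal_gen B" using gs(1) by (intro ideal_gen_subset) auto
  then have "LT_ideal \<sigma> (ideal_gen (set gs)) = LT_ideal \<sigma> (set gs)"
    using LT_ideal_mono[OF sub, of \<sigma>] LT_ideal_mono[of "ideal_gen (set gs)" "ideal_gen B" \<sigma>] gs(2) by blast
  then have "is_reduced_Groebner_basis \<sigma> (ideal_gen (set gs)) (set gs)"
    using red gs(1) sub unfolding is_reduced_Groebner_basis_def is_Groebner_basis_def by auto
  moreover have "make_monic \<sigma> ` set gs = set gs"
    using gs(3) by (simp add: make_monic_def const_1)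
  moreover have "separating_ordering_tuple zs gs \<sigma>"
    using LT_gs \<sigma> by (simp add: separating_ordering_tuple_def Sep_def)
  ultimately show ?thesis unfolding coherently_separating_tuple_def by auto
qed

text \<open>
  A reduced form of \<open>z\<close>, obtained from any separating ordering \<open>\<tau>\<close>, has \<open>z\<close> as its only term
  outside \<open>K[Y]\<close>. As it does not lie in \<open>K[Y]\<close>, its leading term for an elimination ordering does
  not either, hence equals \<open>z\<close>.
\<close>

lemma elimination_ordering_in_Sep:
  fixes B :: "('n::finite, 'k::field) mpoly set"
  assumes "separating_ideal zs (ideal_gen B)" and elim: "elimination_ordering TYPE('k) zs \<sigma>"
  shows "\<sigma> \<in> Sep zs (ideal_gen B)"
proof -
  obtain \<tau> where \<tau>: "\<tau> \<in> Sep zs (ideal_gen B)" using assms(1) unfolding separating_ideal_def by blast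
  have el: "f \<in> polys_in (- set zs)" if "f \<noteq> 0" "Poly_Mapping.keys (LT \<sigma> f) \<subseteq> - set zs"
    for f :: "('n, 'k) mpoly"
    using elim that by (auto simp: elimination_ordering_def polys_in_def monomial_of_def)
  interpret \<tau>: term_order \<tau> using SepD(1)[OF \<tau>] .
  have \<sigma>: "term_ordering \<sigma>" using elim by (simp add: elimination_ordering_def)
  interpret term_order \<sigma> using \<sigma> by unfold_locales
  note I = SepD(2)[OF \<tau>]
  have "LT_ideal \<sigma> (ideal_gen B) = indet_ideal (set zs)"
  proof (rule LT_ideal_eqI)
    fix z assume z: "z \<in> set zs"
    obtain g where g: "g \<in> ideal_gen B" "g - monomial_of (indet z) \<in> polys_in (- set zs)"
      using \<tau>.reduced_form_exists[OF I] by blast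
    have keys_g: "Poly_Mapping.lookup g (indet z) = 1"
      "\<forall>t\<in>Poly_Mapping.keys g - {indet z}. Poly_Mapping.keys t \<inter> set zs = {}"
      using g(2) unfolding monic_diff_indet_iff[OF z] by auto
    then have g0: "g \<noteq> 0" by auto
    have "indet z \<in> Poly_Mapping.keys g" using keys_g(1) by (simp add: in_keys_iff)
    then have "g \<notin> polys_in (- set zs)" using z by (force simp: polys_in_def)
    then have "\<not> Poly_Mapping.keys (LT \<sigma> g) \<subseteq> - set zs" using el[OF g0] by blast
    then have "LT \<sigma> g = indet z" using keys_g(2) LT_in_keys[OF g0] by blast
    then show "\<exists>g\<in>ideal_gen B - {0}. LT \<sigma> g = indet z" using g(1) g0 by blast
  next
    fix f assume "f \<in> ideal_gen B" "f \<in> polys_in (- set zs)"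
    then show "f = 0" by (rule \<tau>.LT_ideal_eqD[OF I])
  qed
  then show ?thesis using \<sigma> by (simp add: Sep_def)
qed

lemma separating_ordering_tuple_interreduction:
  fixes fs :: "('n::finite, 'k::field) mpoly list"
  assumes sep: "separating_ordering_tuple zs fs \<sigma>"
    and dist: "distinct zs" and len: "length fs = length zs" and nz: "\<And>i. i < length zs \<Longrightarrow> fs ! i \<noteq> 0"
  shows "\<exists>G. is_reduced_Groebner_basis \<sigma> (ideal_gen (set fs)) G \<and>
    interreduction_yields \<sigma> (map (make_monic \<sigma>) fs) G"
proof -
  interpret term_order \<sigma>
    using sep by unfold_locales (simp add: separating_ordering_tuple_def)
  have "monic_with_LT zs (ideal_gen (set fs)) (map (make_monic \<sigma>) fs)"
    unfolding monic_with_LT_def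
  proof (intro conjI allI impI)
    show "length (map (make_monic \<sigma>) fs) = length zs" by (simp add: len)
    fix i assume i: "i < length zs"
    then have eq: "map (make_monic \<sigma>) fs ! i = make_monic \<sigma> (fs ! i)" by (simp add: len)
    show "map (make_monic \<sigma>) fs ! i \<in> ideal_gen (set fs)"
      unfolding eq make_monic_def using i len by (intro ideal_gen_mult ideal_gen_base) simp
    show "LT \<sigma> (map (make_monic \<sigma>) fs ! i) = indet (zs ! i)"
      unfolding eq LT_make_monic[OF nz[OF i]] using sep i by (simp add: separating_ordering_tuple_def)
    show "LC \<sigma> (map (make_monic \<sigma>) fs ! i) = 1"
      unfolding eq by (rule LC_make_monic[OF nz[OF i]])
    then show "map (make_monic \<sigma>) fs ! i \<noteq> 0" by (auto simp: LC_def)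
  qed
  then show ?thesis
    using separating_ordering_tuple_LT_ideal[OF sep dist len nz] dist
    by (intro interreduction_yields_reduced_Groebner_basis)
qed

theorem proposition2p2:
  fixes s :: nat
    and zs :: "'n::finite list"
    and fs :: "('n, 'k::field) mpoly list"
  assumes s: "1 \<le> s" "s \<le> CARD('n)"
    and zs: "length zs = s" "distinct zs"
    and fs: "length fs = s" "\<forall>i<s. fs ! i \<in> indet_ideal UNIV - {0}"
  shows
    \<comment> \<open>(a)\<close>
    "(separating_tuple zs fs \<longrightarrow> (\<forall>i<s. separating_poly (zs ! i) (fs ! i))) \<and>
    \<comment> \<open>(b)\<close>
     (coherently_separating_tuple zs fs \<longleftrightarrow>
        (\<forall>i<s. separating_poly (zs ! i) (fs ! i)) \<and>
        (\<forall>i<s. \<forall>j<s. j \<noteq> i \<longrightarrow> (\<forall>t\<in>Poly_Mapping.keys (fs ! j). \<not> pp_dvd (indet (zs ! i)) t))) \<and>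
    \<comment> \<open>(c)\<close>
     (separating_ideal zs (ideal_gen (set fs)) \<longrightarrow>
        (\<forall>\<sigma>\<in>Sep zs (ideal_gen (set fs)).
           let lists_reduced_GB = (\<lambda>gs. length gs = s \<and>
                 is_reduced_Groebner_basis \<sigma> (ideal_gen (set fs)) (set gs) \<and>
                 (\<forall>i<s. LT \<sigma> (gs ! i) = indet (zs ! i)))
           in (\<exists>gs. lists_reduced_GB gs) \<and>
              (\<forall>gs. lists_reduced_GB gs \<longrightarrow> coherently_separating_tuple zs gs))) \<and>
    \<comment> \<open>(d)\<close>
     (separating_tuple zs fs \<longrightarrow>
        (\<forall>\<sigma>. separating_ordering_tuple zs fs \<sigma> \<longrightarrow>
           separating_ideal zs (ideal_gen (set fs)) \<and>
           \<sigma> \<in> Sep zs (ideal_gen (set fs)) \<and>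
           (\<exists>G. is_reduced_Groebner_basis \<sigma> (ideal_gen (set fs)) G \<and>
                interreduction_yields \<sigma> (map (make_monic \<sigma>) fs) G))) \<and>
    \<comment> \<open>(e)\<close>
     (separating_ideal zs (ideal_gen (set fs)) \<longrightarrow>
        (\<forall>\<sigma>. elimination_ordering TYPE('k) zs \<sigma> \<longrightarrow> \<sigma> \<in> Sep zs (ideal_gen (set fs))))"
proof -
  have len: "length fs = length zs" using zs fs by simp
  have nz: "fs ! i \<noteq> 0" if "i < length zs" for i using that zs fs by auto
  have a: "separating_poly (zs ! i) (fs ! i)"
    if sep: "separating_ordering_tuple zs fs \<sigma>" and i: "i < s" for \<sigma> i
  proof -
    interpret term_order \<sigma>
      using sep by unfold_locales (simp add: separating_ordering_tuple_def)
    show ?thesis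
      using sep i zs(1) nz by (intro LT_indet_separating) (auto simp: separating_ordering_tuple_def)
  qed
  have b: "coherently_separating_tuple zs fs \<longleftrightarrow>
      (\<forall>i<s. separating_poly (zs ! i) (fs ! i)) \<and>
      (\<forall>i<s. \<forall>j<s. j \<noteq> i \<longrightarrow> (\<forall>t\<in>Poly_Mapping.keys (fs ! j). \<not> pp_dvd (indet (zs ! i)) t))"
    (is "_ \<longleftrightarrow> ?sep \<and> ?other")
  proof
    assume coh: "coherently_separating_tuple zs fs"
    then have ?sep using a unfolding coherently_separating_tuple_def by blast
    moreover have ?other
      using coherently_separating_tupleD[OF coh zs(2) len nz] zs(1) by auto
    ultimately show "?sep \<and> ?other" ..
  next
    assume "?sep \<and> ?other"
    then show "coherently_separating_tuple zs fs"
      using zs by (intro coherently_separating_tupleI[OF zs(2) len]) auto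
  qed
  have c: "let lists_reduced_GB = (\<lambda>gs. length gs = s \<and>
         is_reduced_Groebner_basis \<sigma> (ideal_gen (set fs)) (set gs) \<and>
         (\<forall>i<s. LT \<sigma> (gs ! i) = indet (zs ! i)))
       in (\<exists>gs. lists_reduced_GB gs) \<and>
          (\<forall>gs. lists_reduced_GB gs \<longrightarrow> coherently_separating_tuple zs gs)"
    if "\<sigma> \<in> Sep zs (ideal_gen (set fs))" for \<sigma>
    using Sep_reduced_Groebner_basis_exists[OF that zs(2)] Sep_reduced_Groebner_basis_coherent[OF that]
    unfolding Let_def zs(1) by blast
  have d: "\<sigma> \<in> Sep zs (ideal_gen (set fs))" if "separating_ordering_tuple zs fs \<sigma>" for \<sigma>
    using separating_ordering_tuple_LT_ideal[OF that zs(2) len nz] that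
    by (simp add: Sep_def separating_ordering_tuple_def)
  show ?thesis
    using a b c d separating_ordering_tuple_interreduction[OF _ zs(2) len nz]
      elimination_ordering_in_Sep[of zs "set fs"]
    unfolding separating_tuple_def separating_ideal_def by (intro conjI) blast+
qed

end
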